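(* Let $\{F_k\}_{k\ge 0}$, $F_k:\mathbf{B}_n\to\mathbf{B}_{N_k}$, be a Whitney sequence of proper mappings. Then each $F_k$ is homotopic to a monomial proper mapping of degree $k+1$ (from $\mathbf{B}_n$ to $\mathbf{B}_{N_k}$).
   Context: $\mathbf{B}_n$ denotes the open unit ball in $\mathbf{C}^n$. A holomorphic map between balls is proper if inverse images of compact sets are compact. Two proper holomorphic maps $f,g:\mathbf{B}_n\to\mathbf{B}_N$ are homotopic if there is a continuous function $H:\mathbf{B}_n\times[0,1]\to\mathbf{C}^N$, holomorphic in the first variable, such that for each $t\in[0,1]$ the map $H_t(z)=H(z,t)$ is a proper holomorphic map from $\mathbf{B}_n$ to $\mathbf{B}_N$, with $H_0=f$ and $H_1=g$. A Whitney sequence is a sequence $F_0,F_1,\dots$ of rational proper maps $F_k:\mathbf{B}_n\to\mathbf{B}_{N_k}$ obtained as follows. $F_0=\phi_0$ is a holomorphic automorphism of $\mathbf{B}_n$ (so $N_0=n$). Given $F_k:\mathbf{B}_n\to\mathbf{B}_{N_k}$, choose a non-zero subspace $A_k$ of $\mathbf{C}^{N_k}$ with orthogonal projection $\pi_k$ onto $A_k$, a holomorphic automorphism $\phi_k$ of $\mathbf{B}_n$, and a linear norm-preserving injection $j_k$ into some $\mathbf{C}^{N_{k+1}}$, and put $$F_{k+1}=j_k\circ\big((\pi_kF_k\otimes\phi_k)\oplus(1-\pi_k)F_k\big),$$ where $\pi_kF_k\otimes\phi_k$ takes values in $A_k\otimes\mathbf{C}^n$ and $(1-\pi_k)F_k$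 in the orthogonal complement $A_k^\perp$ (with the standard Hermitian inner products). A monomial mapping is one each of whose components is a constant times a monomial in $z_1,\dots,z_n$; its degree is the maximal degree of its non-zero components. *)

theory Defs
  imports "HOL-Analysis.Analysis" "HOL-Library.Function_Algebras"
begin

text \<open>
  The source \<open>C\<^sup>n\<close> is the type \<^typ>\<open>complex ^ 'n\<close>. The target dimension varies along a Whitney
  sequence, so \<open>C\<^sup>N\<close> is the set of functions \<^typ>\<open>nat \<Rightarrow> complex\<close> vanishing at all \<open>i \<ge> N\<close>; on this
  set the product topology is the usual topology. Tensor products and orthogonal sums are function
  spaces over product and sum index types.
\<close>

definition cspace :: "nat \<Rightarrow> (nat \<Rightarrow> complex) set" where
  "cspace N = {v. \<forall>i\<ge>N. v i = 0}"

definition cscale :: "complex \<Rightarrow> ('i \<Rightarrow> complex) \<Rightarrow> 'i \<Rightarrow> complex" where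
  "cscale c v = (\<lambda>i. c * v i)"

interpretation cfun: vector_space cscale
  by unfold_locales (auto simp: cscale_def fun_eq_iff algebra_simps)

definition cnorm :: "'i set \<Rightarrow> ('i \<Rightarrow> complex) \<Rightarrow> real" where
  "cnorm I v = L2_set (\<lambda>i. cmod (v i)) I"

definition hinner :: "nat \<Rightarrow> (nat \<Rightarrow> complex) \<Rightarrow> (nat \<Rightarrow> complex) \<Rightarrow> complex" where
  "hinner N v w = (\<Sum>i<N. v i * cnj (w i))"

definition unit_ball :: "nat \<Rightarrow> (nat \<Rightarrow> complex) set" where
  "unit_ball N = {v \<in> cspace N. cnorm {..<N} v < 1}"

text \<open>Holomorphy on an open set: complex differentiability, i.e. the real Frechet derivative is
  complex linear.\<close>

definition mholomorphic_on :: "(complex ^ 'n::finite \<Rightarrow> complex) \<Rightarrow> (complex ^ 'n) set \<Rightarrow> bool" where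
  "mholomorphic_on f S \<longleftrightarrow>
     (\<forall>z\<in>S. \<exists>L. (f has_derivative L) (at z) \<and> (\<forall>c v. L (c *s v) = c * L v))"

definition proper_holomorphic :: "nat \<Rightarrow> (complex ^ 'n::finite \<Rightarrow> nat \<Rightarrow> complex) \<Rightarrow> bool" where
  "proper_holomorphic N f \<longleftrightarrow>
     f ` ball 0 1 \<subseteq> unit_ball N \<and>
     (\<forall>i<N. mholomorphic_on (\<lambda>z. f z i) (ball 0 1)) \<and>
     (\<forall>K. K \<subseteq> unit_ball N \<and> compact K \<longrightarrow> compact {z \<in> ball 0 1. f z \<in> K})"

text \<open>In the library notion the parameter in \<open>[0,1]\<close> is the first argument of the homotopy. Values
  outside the open unit ball play no role: the homotopy may be chosen freely there.\<close>

definition homotopic_proper ::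
  "nat \<Rightarrow> (complex ^ 'n::finite \<Rightarrow> nat \<Rightarrow> complex) \<Rightarrow> (complex ^ 'n \<Rightarrow> nat \<Rightarrow> complex) \<Rightarrow> bool" where
  "homotopic_proper N f g \<longleftrightarrow>
     homotopic_with_canon (proper_holomorphic N) (ball 0 1) (cspace N) f g"

definition ball_automorphism :: "(complex ^ 'n::finite \<Rightarrow> complex ^ 'n) \<Rightarrow> bool" where
  "ball_automorphism \<phi> \<longleftrightarrow>
     bij_betw \<phi> (ball 0 1) (ball 0 1) \<and>
     (\<forall>l. mholomorphic_on (\<lambda>z. \<phi> z $ l) (ball 0 1)) \<and>
     (\<forall>l. mholomorphic_on (\<lambda>w. inv_into (ball 0 1) \<phi> w $ l) (ball 0 1))"

definition orth_proj :: "nat \<Rightarrow> (nat \<Rightarrow> complex) set \<Rightarrow> (nat \<Rightarrow> complex) \<Rightarrow> nat \<Rightarrow> complex" where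
  "orth_proj N A v = (THE a. a \<in> A \<and> (\<forall>b\<in>A. hinner N (v - a) b = 0))"

definition orth_compl :: "nat \<Rightarrow> (nat \<Rightarrow> complex) set \<Rightarrow> (nat \<Rightarrow> complex) set" where
  "orth_compl N A = {v \<in> cspace N. \<forall>a\<in>A. hinner N v a = 0}"

definition tensor :: "(nat \<Rightarrow> complex) \<Rightarrow> complex ^ 'n \<Rightarrow> nat \<times> 'n \<Rightarrow> complex" where
  "tensor v w = (\<lambda>(i, l). v i * w $ l)"

text \<open>\<open>(A \<otimes> C\<^sup>n) \<oplus> A\<^sup>\<bottom>\<close> for a subspace \<open>A\<close> of \<open>C\<^sup>N\<close>.\<close>

definition tensor_sum_space ::
  "nat \<Rightarrow> (nat \<Rightarrow> complex) set \<Rightarrow> ((nat \<times> 'n::finite) + nat \<Rightarrow> complex) set" where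
  "tensor_sum_space N A =
     {case_sum T v | T v. T \<in> cfun.span {tensor a w | a w. a \<in> A} \<and> v \<in> orth_compl N A}"

text \<open>Norm preservation makes the linear map injective on the given space.\<close>

definition linear_isometry_on ::
  "('i \<Rightarrow> complex) set \<Rightarrow> 'i set \<Rightarrow> nat \<Rightarrow> (('i \<Rightarrow> complex) \<Rightarrow> nat \<Rightarrow> complex) \<Rightarrow> bool" where
  "linear_isometry_on W I M j \<longleftrightarrow>
     (\<forall>x\<in>W. j x \<in> cspace M \<and> cnorm {..<M} (j x) = cnorm I x) \<and>
     (\<forall>x\<in>W. \<forall>y\<in>W. j (x + y) = j x + j y) \<and>
     (\<forall>c. \<forall>x\<in>W. j (cscale c x) = cscale c (j x))"

definition whitney_step ::
  "nat \<Rightarrow> nat \<Rightarrow> (complex ^ 'n::finite \<Rightarrow> nat \<Rightarrow> complex) \<Rightarrow> (complex ^ 'n \<Rightarrow> nat \<Rightarrow> complex) \<Rightarrow> bool"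
  where
  "whitney_step N M F G \<longleftrightarrow>
     (\<exists>A \<phi> j. cfun.subspace A \<and> A \<subseteq> cspace N \<and> A \<noteq> {0} \<and>
        ball_automorphism \<phi> \<and>
        linear_isometry_on (tensor_sum_space N A) (({..<N} \<times> UNIV) <+> {..<N}) M j \<and>
        (\<forall>z\<in>ball 0 1. G z =
           j (case_sum (tensor (orth_proj N A (F z)) (\<phi> z)) (F z - orth_proj N A (F z)))))"

text \<open>The bijection \<open>e\<close> identifies \<^typ>\<open>complex ^ 'n\<close> with \<open>cspace CARD('n)\<close>. Which one is used is
  immaterial, since permuting coordinates is a ball automorphism.\<close>

definition whitney_sequence ::
  "(nat \<Rightarrow> nat) \<Rightarrow> (nat \<Rightarrow> complex ^ 'n::finite \<Rightarrow> nat \<Rightarrow> complex) \<Rightarrow> bool" where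
  "whitney_sequence N F \<longleftrightarrow>
     N 0 = CARD('n) \<and>
     (\<exists>\<phi> e. ball_automorphism \<phi> \<and> bij_betw e {..<CARD('n)} (UNIV :: 'n set) \<and>
        (\<forall>z\<in>ball 0 1. F 0 z = (\<lambda>i. if i < CARD('n) then \<phi> z $ e i else 0))) \<and>
     (\<forall>k. whitney_step (N k) (N (Suc k)) (F k) (F (Suc k)))"

text \<open>The map to \<open>C\<^sup>N\<close> with components \<open>c\<^sub>i z\<^bsup>\<alpha> i\<^esup>\<close>. Its degree is meaningful if some \<open>c\<^sub>i\<close> with
  \<open>i < N\<close> is non-zero, in particular if the map is proper.\<close>

definition monomial_map ::
  "nat \<Rightarrow> (nat \<Rightarrow> complex) \<Rightarrow> (nat \<Rightarrow> 'n \<Rightarrow> nat) \<Rightarrow> complex ^ 'n::finite \<Rightarrow> nat \<Rightarrow> complex" where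
  "monomial_map N c \<alpha> z = (\<lambda>i. if i < N then c i * (\<Prod>l\<in>UNIV. (z $ l) ^ \<alpha> i l) else 0)"

definition monomial_degree ::
  "nat \<Rightarrow> (nat \<Rightarrow> complex) \<Rightarrow> (nat \<Rightarrow> 'n::finite \<Rightarrow> nat) \<Rightarrow> nat" where
  "monomial_degree N c \<alpha> = Max {\<Sum>l\<in>UNIV. \<alpha> i l | i. i < N \<and> c i \<noteq> 0}"

end

theory Submission imports Defs "HOL-Complex_Analysis.Conformal_Mappings" begin

text \<open>
  Everything that is chosen in a Whitney step can be deformed. An automorphism \<open>\<phi>\<close> of the ball with
  \<open>\<phi> 0 = a\<close> is \<open>\<iota>\<^sub>a \<circ> L\<close>, where \<open>\<iota>\<^sub>a\<close> is the involutive automorphism exchanging \<open>0\<close> and \<open>a\<close> and \<open>L\<close> fixes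
  \<open>0\<close>; by the equality case of the Schwarz lemma \<open>L\<close> is linear, hence unitary. Letting \<open>a\<close> tend to \<open>0\<close>
  deforms \<open>\<phi>\<close> to the unitary map \<open>- L\<close>, and unitary maps can be deformed to the identity. In an
  orthonormal basis adapted to the subspace, the step applied to \<open>F\<close> is \<open>V\<close> applied to the step for a
  coordinate subspace applied to \<open>U\<^sup>* F\<close>, with \<open>U\<close> and \<open>V\<close> unitary. Hence the new map is homotopic to the
  coordinate step applied to a monomial map and the identity, which is again monomial. The coordinate
  subspace is chosen to contain a coordinate in which the monomial map has its maximal degree, so the
  degree rises by exactly one.
\<close>

section \<open>Hermitian products and orthonormal families\<close>

text \<open>Both factors of a Whitney step can move at once because of an identity for the defect:
  if G is the step applied to F and phi, then 1 - |G|^2 = (1 - |F|^2) + |pi F|^2 (1 - |phi|^2). Both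
  summands are controlled by the defects of F and phi, so properness survives simultaneous
  deformation; for this purpose properness is recast as the statement that the defect tends to 0 at
  the sphere. The obstacle is that a homotopy from F to a monomial map does not respect the subspace
  A. Hence F is rotated first: its coordinates in a basis adapted to A form a map homotopic to F,
  thus to the same monomial map, and for them A has become a coordinate subspace. The position of
  that coordinate subspace is free, and since A is non-zero there is room for one prescribed index.
  On the target side a step prescribes only p orthonormal vectors in C^M with p <= M, so unitary
  maps are constructed from orthonormal families that may be shorter than the dimension.\<close>

definition cip :: "'i set \<Rightarrow> ('i \<Rightarrow> complex) \<Rightarrow> ('i \<Rightarrow> complex) \<Rightarrow> complex" where
  "cip I v w = (\<Sum>i\<in>I. v i * cnj (w i))"

text \<open>All computations go through \<open>cip\<close>, since index sets other than
  \<open>{..<N}\<close> occur: \<open>UNIV\<close> for the source space and a sum type for the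
  tensor sum.\<close>

lemma hinner_eq_cip: "hinner N = cip {..<N}"
  by (simp add: fun_eq_iff hinner_def cip_def)

lemma cscale_apply [simp]: "cscale c v i = c * v i"
  by (simp add: cscale_def)

lemma sum_fun_apply: "(\<Sum>k\<in>K. f k) i = (\<Sum>k\<in>K. f k i)"
  for f :: "'k \<Rightarrow> 'i \<Rightarrow> 'a::comm_monoid_add"
  by (induction K rule: infinite_finite_induct) auto

lemma cip_add_left: "cip I (u + v) w = cip I u w + cip I v w"
  by (simp add: cip_def algebra_simps sum.distrib)

lemma cip_add_right: "cip I u (v + w) = cip I u v + cip I u w"
  by (simp add: cip_def algebra_simps sum.distrib)

lemma cip_diff_left: "cip I (u - v) w = cip I u w - cip I v w"
  by (simp add: cip_def algebra_simps sum_subtractf)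

lemma cip_diff_right: "cip I u (v - w) = cip I u v - cip I u w"
  by (simp add: cip_def algebra_simps sum_subtractf)

lemma cip_scale_left: "cip I (cscale c v) w = c * cip I v w"
  by (simp add: cip_def algebra_simps sum_distrib_left)

lemma cip_scale_right: "cip I v (cscale c w) = cnj c * cip I v w"
  by (simp add: cip_def algebra_simps sum_distrib_left)

lemma cip_commute: "cip I w v = cnj (cip I v w)"
  by (simp add: cip_def mult.commute)

lemma cip_zero_left [simp]: "cip I 0 w = 0"
  by (simp add: cip_def)

lemma cip_zero_right [simp]: "cip I w 0 = 0"
  by (simp add: cip_def)

lemma cip_sum_left: "cip I (\<Sum>k\<in>K. f k) w = (\<Sum>k\<in>K. cip I (f k) w)"
  by (simp add: cip_def sum_fun_apply sum_distrib_right) (rule sum.swap)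

lemma cip_sum_right: "cip I w (\<Sum>k\<in>K. f k) = (\<Sum>k\<in>K. cip I w (f k))"
  by (simp add: cip_def sum_fun_apply sum_distrib_left) (rule sum.swap)

lemmas cip_simps = cip_add_left cip_add_right cip_diff_left cip_diff_right
  cip_scale_left cip_scale_right cip_sum_left cip_sum_right

lemma cnorm_nonneg [simp]: "0 \<le> cnorm I v"
  by (simp add: cnorm_def)

lemma cnorm_power2: "(cnorm I v)\<^sup>2 = (\<Sum>i\<in>I. (cmod (v i))\<^sup>2)"
  by (simp add: cnorm_def L2_set_def sum_nonneg)

lemma cip_self: "cip I v v = of_real ((cnorm I v)\<^sup>2)"
  by (simp add: cip_def cnorm_def L2_set_def sum_nonneg complex_norm_square flip: of_real_power)

lemma cip_self_norm: "(cnorm I v)\<^sup>2 = Re (cip I v v)"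
  by (simp add: cip_self)

lemma cnorm_eq_0_iff: "finite I \<Longrightarrow> cnorm I v = 0 \<longleftrightarrow> (\<forall>i\<in>I. v i = 0)"
  by (simp add: cnorm_def L2_set_eq_0_iff)

lemma norm_cip_le: "cmod (cip I v w) \<le> cnorm I v * cnorm I w"
proof -
  have "cmod (cip I v w) \<le> (\<Sum>i\<in>I. \<bar>cmod (v i)\<bar> * \<bar>cmod (w i)\<bar>)"
    unfolding cip_def by (rule sum_norm_le) (simp add: norm_mult)
  also have "\<dots> \<le> cnorm I v * cnorm I w"
    unfolding cnorm_def by (rule L2_set_mult_ineq)
  finally show ?thesis .
qed

lemma cnorm_scale: "cnorm I (cscale c v) = cmod c * cnorm I v"
  by (simp add: cnorm_def norm_mult L2_set_right_distrib)

text \<open>Turns preservation of norms by a linear map into preservation of Hermitian products. The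
  two sides may have different index sets, as is the case for the isometries of a Whitney
  step.\<close>

lemma polarization:
  assumes "\<And>c. cnorm I (x + cscale c y) = cnorm J (x' + cscale c y')"
  shows "cip I x y = cip J x' y'"
proof -
  have "(cnorm I (x + cscale c y))\<^sup>2 = (cnorm J (x' + cscale c y'))\<^sup>2" for c
    by (simp add: assms)
  then have *: "Re (cip I x x + c * cip I y x + cnj c * cip I x y + c * cnj c * cip I y y) =
     Re (cip J x' x' + c * cip J y' x' + cnj c * cip J x' y' + c * cnj c * cip J y' y')" for c
    by (simp add: cip_self_norm cip_simps algebra_simps)
  \<comment> \<open>The values 1 and -1 isolate the real part of the product, the values \<i> and
    -\<i> its imaginary part.\<close>
  show ?thesis
    using *[of 1] *[of "-1"] *[of \<i>] *[of "-\<i>"] cip_commute[of I y x] cip_commute[of J y' x']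
    by (simp add: complex_eq_iff)
qed

lemma cspace_subspace: "cfun.subspace (cspace N)"
  by (auto simp: cfun.subspace_def cspace_def)

lemmas cspace_add = cfun.subspace_add[OF cspace_subspace]
  and cspace_diff = cfun.subspace_diff[OF cspace_subspace]
  and cspace_scale = cfun.subspace_scale[OF cspace_subspace]
  and cspace_sum = cfun.subspace_sum[OF cspace_subspace]
  and cspace_zero = cfun.subspace_0[OF cspace_subspace]

lemma cspace_eq_0:
  assumes "v \<in> cspace N" "hinner N v v = 0"
  shows "v = 0"
proof
  fix i
  have "cnorm {..<N} v = 0" using assms by (simp add: hinner_eq_cip cip_self)
  then show "v i = 0 i"
    using assms(1) by (cases "i < N") (auto simp: cnorm_eq_0_iff cspace_def)
qed

text \<open>Only the first \<open>d\<close> values of \<open>a\<close> count, so a family is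
  lengthened by a function update.\<close>

definition orthonormal :: "nat \<Rightarrow> nat \<Rightarrow> (nat \<Rightarrow> nat \<Rightarrow> complex) \<Rightarrow> bool" where
  "orthonormal N d a \<longleftrightarrow>
     (\<forall>i<d. a i \<in> cspace N \<and> (\<forall>j<d. hinner N (a i) (a j) = of_bool (i = j)))"

lemma orthonormal_less: "orthonormal N d a \<Longrightarrow> e \<le> d \<Longrightarrow> orthonormal N e a"
  by (auto simp: orthonormal_def)

lemma orthonormal_cspace: "orthonormal N d a \<Longrightarrow> i < d \<Longrightarrow> a i \<in> cspace N"
  by (simp add: orthonormal_def)

lemma orthonormal_cip:
  "orthonormal N d a \<Longrightarrow> i < d \<Longrightarrow> j < d \<Longrightarrow> cip {..<N} (a i) (a j) = of_bool (i = j)"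
  by (simp add: orthonormal_def hinner_eq_cip)

definition unit_vec :: "nat \<Rightarrow> nat \<Rightarrow> complex" where
  "unit_vec i = (\<lambda>k. of_bool (k = i))"

lemma unit_vec_cspace: "i < N \<Longrightarrow> unit_vec i \<in> cspace N"
  by (auto simp: unit_vec_def cspace_def)

lemma hinner_unit_vec_right: "i < N \<Longrightarrow> hinner N v (unit_vec i) = v i"
  by (simp add: hinner_def unit_vec_def of_bool_def if_distrib cong: if_cong)

lemma orthonormal_unit_vec: 
  assumes "inj_on s {..<d}" "s ` {..<d} \<subseteq> {..<N}"
  shows "orthonormal N d (\<lambda>i. unit_vec (s i))"
proof -
  have "hinner N (unit_vec (s i)) (unit_vec (s j)) = of_bool (i = j)" if "i < d" "j < d" for i j
  proof -
    have "s j < N" using that assms by auto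
    then have "hinner N (unit_vec (s i)) (unit_vec (s j)) = unit_vec (s i) (s j)"
      by (rule hinner_unit_vec_right)
    then show ?thesis using that assms by (auto simp: unit_vec_def inj_on_def)
  qed
  then show ?thesis
    using assms by (auto simp: orthonormal_def intro!: unit_vec_cspace)
qed

lemma hinner_orthonormal_sum:
  assumes "orthonormal N d a" "j < d"
  shows "hinner N (\<Sum>i<d. cscale (c i) (a i)) (a j) = c j"
proof -
  have "hinner N (\<Sum>i<d. cscale (c i) (a i)) (a j) = (\<Sum>i<d. c i * cip {..<N} (a i) (a j))"
    by (simp add: hinner_eq_cip cip_simps)
  also have "\<dots> = (\<Sum>i<d. c i * of_bool (i = j))"
    by (rule sum.cong) (use assms in \<open>auto simp: orthonormal_cip\<close>)
  also have "\<dots> = c j" using assms(2) by (simp add: of_bool_def if_distrib cong: if_cong)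
  finally show ?thesis .
qed

lemma cnorm_orthonormal_sum:
  assumes "orthonormal N d a"
  shows "(cnorm {..<N} (\<Sum>i<d. cscale (c i) (a i)))\<^sup>2 = (\<Sum>i<d. (cmod (c i))\<^sup>2)"
proof -
  let ?v = "\<Sum>i<d. cscale (c i) (a i)"
  have "cip {..<N} ?v ?v = (\<Sum>j<d. cnj (c j) * hinner N ?v (a j))"
    unfolding cip_sum_right by (simp add: cip_scale_right hinner_eq_cip)
  also have "\<dots> = (\<Sum>j<d. cnj (c j) * c j)"
    using hinner_orthonormal_sum[OF assms] by simp
  also have "\<dots> = of_real (\<Sum>i<d. (cmod (c i))\<^sup>2)"
    by (simp add: complex_norm_square mult.commute del: of_real_power)
  finally show ?thesis by (metis cip_self of_real_eq_iff)
qed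

lemma hinner_residual:
  assumes "orthonormal N d a" "j < d"
  shows "hinner N (v - (\<Sum>i<d. cscale (hinner N v (a i)) (a i))) (a j) = 0"
  using hinner_orthonormal_sum[OF assms] by (simp add: hinner_eq_cip cip_diff_left)

text \<open>Pythagoras: the projection \<open>p\<close> onto the span is orthogonal to
  \<open>v - p\<close>, and its squared norm is the left-hand side.\<close>

lemma bessel:
  assumes "orthonormal N d a"
  shows "(\<Sum>i<d. (cmod (hinner N v (a i)))\<^sup>2) \<le> (cnorm {..<N} v)\<^sup>2"
proof -
  define p where "p = (\<Sum>i<d. cscale (hinner N v (a i)) (a i))"
  have "cip {..<N} (v - p) p = (\<Sum>i<d. cnj (hinner N v (a i)) * hinner N (v - p) (a i))"
    unfolding p_def by (subst cip_sum_right) (simp add: cip_scale_right hinner_eq_cip)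
  also have "\<dots> = 0" unfolding p_def using hinner_residual[OF assms] by simp
  finally have "cip {..<N} (v - p) p = 0" .
  moreover have "v = (v - p) + p" by simp
  ultimately have "(cnorm {..<N} v)\<^sup>2 = (cnorm {..<N} (v - p))\<^sup>2 + (cnorm {..<N} p)\<^sup>2"
    by (smt (verit) cip_add_left cip_add_right cip_commute cip_self_norm complex_cnj_zero plus_complex.sel(1) zero_complex.sel(1))
  then show ?thesis
    using cnorm_orthonormal_sum[OF assms] by (simp add: p_def)
qed

text \<open>Double counting of the squared entries: summed by vectors they give \<open>d\<close>,
  and by Bessel for \<open>unit_vec k\<close> each of the \<open>N\<close> coordinates contributes
  at most 1. This bound stands in for dimension theory throughout.\<close>

lemma orthonormal_card_le:
  assumes "orthonormal N d a"
  shows "d \<le> N"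
proof -
  have "real d = (\<Sum>i<d. (cnorm {..<N} (a i))\<^sup>2)"
    using orthonormal_cip[OF assms] by (simp add: cip_self_norm)
  also have "\<dots> = (\<Sum>i<d. \<Sum>k<N. (cmod (a i k))\<^sup>2)"
    by (simp add: cnorm_power2)
  also have "\<dots> = (\<Sum>k<N. \<Sum>i<d. (cmod (a i k))\<^sup>2)"
    by (rule sum.swap)
  also have "\<dots> \<le> (\<Sum>k<N. 1)"
  proof (rule sum_mono)
    fix k assume k: "k \<in> {..<N}"
    have "cmod (hinner N (unit_vec k) (a i)) = cmod (a i k)" for i
      using k hinner_unit_vec_right[of k N "a i"] cip_commute[of "{..<N}" "unit_vec k" "a i"]
      by (metis hinner_eq_cip complex_mod_cnj lessThan_iff)
    moreover have "cnorm {..<N} (unit_vec k) = 1"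
      using k hinner_unit_vec_right[of k N "unit_vec k"] cip_self_norm[of "{..<N}" "unit_vec k"]
      by (simp add: hinner_eq_cip unit_vec_def power2_eq_1_iff) (smt (verit) cnorm_nonneg)
    ultimately show "(\<Sum>i<d. (cmod (a i k))\<^sup>2) \<le> 1"
      using bessel[OF assms, of "unit_vec k"] by simp
  qed
  finally show ?thesis by simp
qed

lemma orthonormal_extend:
  assumes a: "orthonormal N d a" and v: "v \<in> cspace N" "v \<noteq> 0"
    and orth: "\<And>i. i < d \<Longrightarrow> hinner N v (a i) = 0"
  shows "\<exists>c. orthonormal N (Suc d) (a(d := cscale c v))"
proof -
  define r where "r = cnorm {..<N} v"
  have r: "r \<noteq> 0" using cspace_eq_0[OF v(1)] v(2) by (auto simp: hinner_eq_cip cip_self r_def)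
  define w where "w = cscale (of_real (1 / r)) v"
  have "hinner N w w = 1"
    using r by (simp add: w_def hinner_eq_cip cip_self cnorm_scale norm_divide flip: r_def)
      (simp add: r_def)
  moreover have "hinner N w (a i) = 0" "hinner N (a i) w = 0" if "i < d" for i
    using orth[OF that] cip_commute[of "{..<N}" "a i" w] by (simp_all add: w_def hinner_eq_cip cip_simps)
  moreover have "w \<in> cspace N" using v by (simp add: w_def cspace_scale)
  ultimately have "orthonormal N (Suc d) (a(d := w))"
    using a by (auto simp: orthonormal_def less_Suc_eq)
  then show ?thesis unfolding w_def by blast
qed

text \<open>An orthonormal family in \<open>A\<close> of greatest length works: the residual of a
  vector that is not expanded by it would be a non-zero vector of \<open>A\<close> extending the
  family.\<close>

lemma orthonormal_basis_exists:
  assumes A: "cfun.subspace A" "A \<subseteq> cspace N"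
  obtains d a where "orthonormal N d a" "\<And>i. i < d \<Longrightarrow> a i \<in> A"
    "\<And>v. v \<in> A \<Longrightarrow> v = (\<Sum>i<d. cscale (hinner N v (a i)) (a i))"
proof -
  define P where "P d \<longleftrightarrow> (\<exists>a. orthonormal N d a \<and> (\<forall>i<d. a i \<in> A))" for d
  have P0: "P 0" by (simp add: P_def orthonormal_def)
  have bound: "d \<le> N" if "P d" for d using that orthonormal_card_le by (auto simp: P_def)
  define d where "d = Greatest P"
  have "P d" unfolding d_def using P0 bound by (rule GreatestI_nat)
  then obtain a where a: "orthonormal N d a" "\<And>i. i < d \<Longrightarrow> a i \<in> A" by (auto simp: P_def)
  have "v = (\<Sum>i<d. cscale (hinner N v (a i)) (a i))" if v: "v \<in> A" for v
  proof (rule ccontr)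
    define w where "w = v - (\<Sum>i<d. cscale (hinner N v (a i)) (a i))"
    assume "v \<noteq> (\<Sum>i<d. cscale (hinner N v (a i)) (a i))"
    then have "w \<noteq> 0" by (simp add: w_def)
    have wA: "w \<in> A" unfolding w_def
      by (intro cfun.subspace_diff cfun.subspace_sum cfun.subspace_scale A(1) v a(2)) simp
    obtain c where "orthonormal N (Suc d) (a(d := cscale c w))"
      using orthonormal_extend[OF a(1), of w] \<open>w \<noteq> 0\<close> wA A(2) hinner_residual[OF a(1)]
      by (auto simp: w_def)
    then have "P (Suc d)"
      using a(2) wA A(1) by (auto simp: P_def less_Suc_eq intro!: exI[of _ "a(d := cscale c w)"] cfun.subspace_scale)
    then have "Suc d \<le> d" unfolding d_def by (rule Greatest_le_nat) (rule bound)
    then show False by simp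
  qed
  then show ?thesis using that a by blast
qed

text \<open>A non-zero residual would give \<open>Suc N\<close> orthonormal vectors in C^N.\<close>

lemma orthonormal_expansion:
  assumes "orthonormal N N u" "v \<in> cspace N"
  shows "v = (\<Sum>i<N. cscale (hinner N v (u i)) (u i))"
proof (rule ccontr)
  let ?w = "v - (\<Sum>i<N. cscale (hinner N v (u i)) (u i))"
  assume "\<not> ?thesis"
  moreover have "?w \<in> cspace N"
    using assms by (intro cspace_diff cspace_sum cspace_scale) (auto simp: orthonormal_def)
  ultimately obtain c where "orthonormal N (Suc N) (u(N := cscale c ?w))"
    using orthonormal_extend[OF assms(1), of ?w] hinner_residual[OF assms(1)] by auto
  then show False using orthonormal_card_le by fastforce
qed

text \<open>Gives the definite description a value. Uniqueness: the difference of two candidates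
  lies in \<open>A\<close> and is orthogonal to \<open>A\<close>, hence to itself.\<close>

lemma orth_proj_orthonormal:
  assumes A: "cfun.subspace A" "A \<subseteq> cspace N"
    and a: "orthonormal N d a" "\<And>i. i < d \<Longrightarrow> a i \<in> A"
    and ex: "\<And>v. v \<in> A \<Longrightarrow> v = (\<Sum>i<d. cscale (hinner N v (a i)) (a i))"
  shows "orth_proj N A v = (\<Sum>i<d. cscale (hinner N v (a i)) (a i))" (is "_ = ?p")
  unfolding orth_proj_def
proof (rule the_equality)
  have pA: "?p \<in> A"
    by (intro cfun.subspace_sum cfun.subspace_scale A(1) a(2)) simp
  have orth: "hinner N (v - ?p) b = 0" if "b \<in> A" for b
  proof -
    have "hinner N (v - ?p) b = (\<Sum>i<d. cnj (hinner N b (a i)) * hinner N (v - ?p) (a i))"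
      by (subst ex[OF that]) (simp add: hinner_eq_cip cip_sum_right cip_scale_right)
    also have "\<dots> = 0" using hinner_residual[OF a(1)] by simp
    finally show ?thesis .
  qed
  show "?p \<in> A \<and> (\<forall>b\<in>A. hinner N (v - ?p) b = 0)" using pA orth by blast
  fix q assume q: "q \<in> A \<and> (\<forall>b\<in>A. hinner N (v - q) b = 0)"
  have "q - ?p \<in> A" using q pA A(1) by (intro cfun.subspace_diff) auto
  moreover have "hinner N (q - ?p) b = 0" if "b \<in> A" for b
    using orth[OF that] q that by (auto simp: hinner_eq_cip cip_simps)
  ultimately show "q = ?p" using cspace_eq_0[of "q - ?p" N] A(2) by auto
qed

section \<open>Proper maps and their homotopies\<close>

lemma mholomorphic_on_const: "mholomorphic_on (\<lambda>z. c) S"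
  by (auto simp: mholomorphic_on_def intro!: exI[of _ "\<lambda>_. 0"])

lemma mholomorphic_on_coord: "mholomorphic_on (\<lambda>z. z $ l) S"
  unfolding mholomorphic_on_def
  by (intro ballI exI[of _ "\<lambda>z. z $ l"] conjI bounded_linear_imp_has_derivative bounded_linear_vec_nth)
     auto

lemma mholomorphic_on_add:
  assumes "mholomorphic_on f S" "mholomorphic_on g S"
  shows "mholomorphic_on (\<lambda>z. f z + g z) S"
  unfolding mholomorphic_on_def
proof
  fix z assume "z \<in> S"
  then obtain L L' where "(f has_derivative L) (at z)" "\<forall>c v. L (c *s v) = c * L v"
    "(g has_derivative L') (at z)" "\<forall>c v. L' (c *s v) = c * L' v"
    using assms unfolding mholomorphic_on_def by blast
  then show "\<exists>L. ((\<lambda>z. f z + g z) has_derivative L) (at z) \<and> (\<forall>c v. L (c *s v) = c * L v)"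
    by (intro exI[of _ "\<lambda>v. L v + L' v"]) (auto intro!: has_derivative_add simp: distrib_left)
qed

lemma mholomorphic_on_mult:
  assumes "mholomorphic_on f S" "mholomorphic_on g S"
  shows "mholomorphic_on (\<lambda>z. f z * g z) S"
  unfolding mholomorphic_on_def
proof
  fix z assume "z \<in> S"
  then obtain L L' where "(f has_derivative L) (at z)" "\<forall>c v. L (c *s v) = c * L v"
    "(g has_derivative L') (at z)" "\<forall>c v. L' (c *s v) = c * L' v"
    using assms unfolding mholomorphic_on_def by blast
  then show "\<exists>L. ((\<lambda>z. f z * g z) has_derivative L) (at z) \<and> (\<forall>c v. L (c *s v) = c * L v)"
    by (intro exI[of _ "\<lambda>v. f z * L' v + L v * g z"]) (auto intro!: has_derivative_mult simp: distrib_left mult.left_commute mult.assoc)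
qed

lemma mholomorphic_on_sum:
  "(\<And>k. k \<in> K \<Longrightarrow> mholomorphic_on (f k) S) \<Longrightarrow> mholomorphic_on (\<lambda>z. \<Sum>k\<in>K. f k z) S"
  by (induction K rule: infinite_finite_induct) (auto intro: mholomorphic_on_add mholomorphic_on_const)

lemma mholomorphic_on_diff:
  assumes "mholomorphic_on f S" "mholomorphic_on g S"
  shows "mholomorphic_on (\<lambda>z. f z - g z) S"
  using mholomorphic_on_add[OF assms(1) mholomorphic_on_mult[OF mholomorphic_on_const[of "-1"] assms(2)]]
  by simp

lemma mholomorphic_on_inverse:
  assumes "mholomorphic_on f S" "\<And>z. z \<in> S \<Longrightarrow> f z \<noteq> 0"
  shows "mholomorphic_on (\<lambda>z. inverse (f z)) S"
  unfolding mholomorphic_on_def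
proof
  fix z assume z: "z \<in> S"
  then obtain L where "(f has_derivative L) (at z)" "\<forall>c v. L (c *s v) = c * L v"
    using assms unfolding mholomorphic_on_def by blast
  then show "\<exists>L. ((\<lambda>z. inverse (f z)) has_derivative L) (at z) \<and> (\<forall>c v. L (c *s v) = c * L v)"
    using assms(2)[OF z]
    by (intro exI[of _ "\<lambda>v. - (inverse (f z) * L v * inverse (f z))"])
       (auto intro!: Deriv.has_derivative_inverse)
qed

lemma mholomorphic_on_cong:
  assumes "mholomorphic_on f S" "open S" "\<And>z. z \<in> S \<Longrightarrow> f z = g z"
  shows "mholomorphic_on g S"
  using assms unfolding mholomorphic_on_def
  by (meson has_derivative_transform_within_open)

lemma mholomorphic_on_imp_continuous_on:
  assumes "mholomorphic_on f S"
  shows "continuous_on S f"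
  using assms unfolding mholomorphic_on_def
  by (meson continuous_at_imp_continuous_on has_derivative_continuous)

section \<open>Properness as boundary behaviour\<close>

lemma continuous_on_cnorm: "continuous_on UNIV (cnorm I)"
  unfolding cnorm_def[abs_def] L2_set_def
  by (intro continuous_intros continuous_on_product_coordinates)

text \<open>A closed subset of a product of closed unit discs and points \<open>{0}\<close>, compact
  by Tychonoff; \<open>r \<le> 1\<close> keeps the coordinates in the unit discs.\<close>

lemma compact_cspace_cball:
  assumes "r \<le> 1"
  shows "compact {v \<in> cspace N. cnorm {..<N} v \<le> r}"
proof -
  let ?P = "PiE UNIV (\<lambda>i. if i < N then cball 0 1 else {0 :: complex})"
  have "compact ?P"
    using compactin_PiE[of "\<lambda>_. euclidean" UNIV "\<lambda>i. if i < N then cball 0 1 else {0 :: complex}"]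
    by (simp add: euclidean_product_topology)
  moreover have "closed {v. cnorm {..<N} v \<le> r}"
    by (intro closed_Collect_le continuous_on_cnorm continuous_on_const)
  ultimately have "compact (?P \<inter> {v. cnorm {..<N} v \<le> r})"
    by (rule compact_Int_closed)
  also have "?P \<inter> {v. cnorm {..<N} v \<le> r} = {v \<in> cspace N. cnorm {..<N} v \<le> r}"
  proof -
    have "cmod (v i) \<le> 1" if "cnorm {..<N} v \<le> r" "i < N" for v i
      using member_le_L2_set[of "{..<N}" i "\<lambda>i. cmod (v i)"] that assms by (simp add: cnorm_def)
    then show ?thesis by (fastforce simp: cspace_def PiE_iff)
  qed
  finally show ?thesis .
qed

lemma ball_maps_continuous_on:
  assumes "\<And>z. z \<in> ball 0 1 \<Longrightarrow> f z \<in> cspace N"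
    and "\<And>i. i < N \<Longrightarrow> mholomorphic_on (\<lambda>z. f z i) (ball 0 1)"
  shows "continuous_on (ball 0 1) f"
proof (rule continuous_on_coordinatewise_then_product)
  fix i
  show "continuous_on (ball 0 1) (\<lambda>z. f z i)"
  proof (cases "i < N")
    case True
    then show ?thesis by (intro mholomorphic_on_imp_continuous_on assms(2))
  next
    case False
    then have "f z i = 0" if "z \<in> ball 0 1" for z using assms(1)[OF that] by (simp add: cspace_def)
    then show ?thesis by (metis continuous_on_const continuous_on_cong)
  qed
qed

text \<open>A compact subset of an open ball lies in a smaller concentric closed ball, so a proper
  map is one whose norm tends to 1 at the sphere. Squared norms are used because the later
  identities are about 1 - |f|^2.\<close>

lemma proper_holomorphic_iff:
  fixes f :: "complex ^ 'n::finite \<Rightarrow> nat \<Rightarrow> complex"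
  shows "proper_holomorphic N f \<longleftrightarrow>
    (\<forall>z\<in>ball 0 1. f z \<in> cspace N \<and> cnorm {..<N} (f z) < 1) \<and>
    (\<forall>i<N. mholomorphic_on (\<lambda>z. f z i) (ball 0 1)) \<and>
    (\<forall>e>0. \<exists>d>0. \<forall>z\<in>ball 0 1. 1 - (norm z)\<^sup>2 < d \<longrightarrow> 1 - (cnorm {..<N} (f z))\<^sup>2 < e)"
    (is "_ \<longleftrightarrow> ?maps \<and> ?hol \<and> ?bd")
proof
  assume f: "proper_holomorphic N f"
  have maps: ?maps using f by (auto simp: proper_holomorphic_def unit_ball_def)
  moreover have ?hol using f by (auto simp: proper_holomorphic_def)
  moreover have ?bd
  proof (intro allI impI)
    fix e :: real assume "e > 0"
    \<comment> \<open>Chosen so that 1 - r^2 is the minimum of 1 and \<open>e\<close>; the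
      \<open>max\<close> covers \<open>e > 1\<close>.\<close>
    define r where "r = sqrt (max 0 (1 - e))"
    have r: "0 \<le> r" "r < 1" "1 - r\<^sup>2 \<le> e" using \<open>e > 0\<close> by (auto simp: r_def)
    define K where "K = {v \<in> cspace N. cnorm {..<N} v \<le> r}"
    define C where "C = {z \<in> ball 0 1. f z \<in> K}"
    have small: "1 - (cnorm {..<N} (f z))\<^sup>2 < e" if "z \<in> ball 0 1" "z \<notin> C" for z
    proof -
      have "r < cnorm {..<N} (f z)" using that maps by (auto simp: C_def K_def)
      then have "r\<^sup>2 < (cnorm {..<N} (f z))\<^sup>2" using r by (intro power_strict_mono) auto
      then show ?thesis using r by linarith
    qed
    have "compact K" unfolding K_def using r by (intro compact_cspace_cball) auto
    moreover have "K \<subseteq> unit_ball N" using r by (auto simp: K_def unit_ball_def)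
    ultimately have C: "compact C" using f by (auto simp: C_def proper_holomorphic_def)
    show "\<exists>d>0. \<forall>z\<in>ball 0 1. 1 - (norm z)\<^sup>2 < d \<longrightarrow> 1 - (cnorm {..<N} (f z))\<^sup>2 < e"
    proof (cases "C = {}")
      case True
      then show ?thesis using small by (intro exI[of _ 1]) auto
    next
      case False
      \<comment> \<open>A point of the compact preimage farthest from the origin: points nearer to
        the sphere than \<open>z0\<close> avoid \<open>C\<close>.\<close>
      then obtain z0 where z0: "z0 \<in> C" "\<forall>z\<in>C. norm z \<le> norm z0"
        using continuous_attains_sup[OF C, of norm] continuous_on_norm_id by auto
      have "norm z0 < 1" using z0 by (simp add: C_def)
      then have "(norm z0)\<^sup>2 < 1" by (simp add: abs_square_less_1)
      moreover have "z \<notin> C" if "1 - (norm z)\<^sup>2 < 1 - (norm z0)\<^sup>2" for z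
        using that z0(2) power_mono[of "norm z" "norm z0" 2] by (meson diff_left_mono leD norm_ge_zero)
      ultimately show ?thesis using small by (intro exI[of _ "1 - (norm z0)\<^sup>2"]) auto
    qed
  qed
  ultimately show "?maps \<and> ?hol \<and> ?bd" by blast
next
  assume A: "?maps \<and> ?hol \<and> ?bd"
  have cont: "continuous_on (ball 0 1) f" using A by (intro ball_maps_continuous_on) auto
  have "compact {z \<in> ball 0 1. f z \<in> K}" if K: "K \<subseteq> unit_ball N" "compact K" for K
  proof (cases "K = {}")
    case False
    then obtain v0 where v0: "v0 \<in> K" "\<forall>v\<in>K. cnorm {..<N} v \<le> cnorm {..<N} v0"
      using continuous_attains_sup[OF K(2) False, of "cnorm {..<N}"] continuous_on_cnorm continuous_on_subset
      by blast
    define r where "r = cnorm {..<N} v0"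
    have r: "0 \<le> r" "r < 1" using v0 K(1) by (auto simp: r_def unit_ball_def)
    then have "1 - r\<^sup>2 > 0" by (simp add: abs_square_less_1)
    then obtain d where d: "d > 0"
      "\<And>z. z \<in> ball 0 1 \<Longrightarrow> 1 - (norm z)\<^sup>2 < d \<Longrightarrow> 1 - (cnorm {..<N} (f z))\<^sup>2 < 1 - r\<^sup>2"
      using A by meson
    \<comment> \<open>A point with 1 - |z|^2 < \<open>d\<close> is mapped to norm larger than
      \<open>r\<close>, hence outside \<open>K\<close>. So the preimage of \<open>K\<close> lies in
      the closed ball of radius \<rho> < 1 and is closed there.\<close>
    define \<rho> where "\<rho> = sqrt (max 0 (1 - d))"
    have \<rho>: "\<rho> < 1" using d by (simp add: \<rho>_def)
    have "norm z \<le> \<rho>" if "z \<in> ball 0 1" "f z \<in> K" for z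
    proof -
      have "(cnorm {..<N} (f z))\<^sup>2 \<le> r\<^sup>2" using that v0(2) by (intro power_mono) (auto simp: r_def)
      then have "(norm z)\<^sup>2 \<le> 1 - d" using d(2)[OF that(1)] by fastforce
      then show ?thesis unfolding \<rho>_def by (intro real_le_rsqrt) auto
    qed
    then have "{z \<in> ball 0 1. f z \<in> K} = cball 0 \<rho> \<inter> f -` K" using \<rho> by auto
    moreover have "closed (cball 0 \<rho> \<inter> f -` K)"
      using \<rho> by (intro continuous_closed_preimage continuous_on_subset[OF cont] compact_imp_closed[OF K(2)]) auto
    ultimately show ?thesis
      by (metis compact_Int_closed compact_cball inf.left_idem)
  qed simp
  then show "proper_holomorphic N f"
    using A by (auto simp: proper_holomorphic_def unit_ball_def)
qed

lemma proper_holomorphic_cong: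
  assumes "proper_holomorphic N f" "\<And>z. z \<in> ball 0 1 \<Longrightarrow> f z = g z"
  shows "proper_holomorphic N g"
proof -
  have "mholomorphic_on (\<lambda>z. g z i) (ball 0 1)" if "i < N" for i
    by (rule mholomorphic_on_cong[of "\<lambda>z. f z i"]) (use assms that in \<open>auto simp: proper_holomorphic_def\<close>)
  then show ?thesis using assms unfolding proper_holomorphic_iff by simp
qed

lemma proper_holomorphic_unit_ball: "proper_holomorphic N f \<Longrightarrow> norm z < 1 \<Longrightarrow> f z \<in> unit_ball N"
  by (simp add: proper_holomorphic_def image_subset_iff)

lemma proper_holomorphic_cspace: "proper_holomorphic N f \<Longrightarrow> norm z < 1 \<Longrightarrow> f z \<in> cspace N"
  and proper_holomorphic_cnorm_less:
    "proper_holomorphic N f \<Longrightarrow> norm z < 1 \<Longrightarrow> cnorm {..<N} (f z) < 1"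
  using proper_holomorphic_unit_ball[of N f z] by (simp_all add: unit_ball_def)

lemma proper_holomorphic_mholomorphic_on:
  "proper_holomorphic N f \<Longrightarrow> i < N \<Longrightarrow> mholomorphic_on (\<lambda>z. f z i) (ball 0 1)"
  by (simp add: proper_holomorphic_def)

lemma proper_holomorphic_continuous_on:
  "proper_holomorphic N f \<Longrightarrow> continuous_on (ball 0 1) (\<lambda>z. f z i)"
  by (rule continuous_on_product_then_coordinatewise, rule ball_maps_continuous_on[of _ N])
     (simp_all add: proper_holomorphic_cspace proper_holomorphic_mholomorphic_on)

lemma proper_holomorphic_continuous_on_snd:
  fixes f :: "complex ^ 'n::finite \<Rightarrow> nat \<Rightarrow> complex"
  assumes "proper_holomorphic N f"
  shows "continuous_on (T \<times> ball 0 1) (\<lambda>x. f (snd x) i)"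
proof -
  have "continuous_on (snd ` (T \<times> ball 0 1)) (\<lambda>z. f z i)"
    by (rule continuous_on_subset[OF proper_holomorphic_continuous_on[OF assms]]) auto
  from continuous_on_compose[OF continuous_on_snd[OF continuous_on_id] this]
  show ?thesis by (simp add: o_def)
qed

lemma proper_holomorphic_boundary:
  assumes "proper_holomorphic N f" "e > 0"
  obtains d where "d > 0"
    "\<And>z. norm z < 1 \<Longrightarrow> 1 - (norm z)\<^sup>2 < d \<Longrightarrow> 1 - (cnorm {..<N} (f z))\<^sup>2 < e"
proof -
  have "\<exists>d>0. \<forall>z\<in>ball 0 1. 1 - (norm z)\<^sup>2 < d \<longrightarrow> 1 - (cnorm {..<N} (f z))\<^sup>2 < e"
    by (rule iffD1[OF proper_holomorphic_iff assms(1), THEN conjunct2, THEN conjunct2, THEN spec,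
          THEN mp, OF assms(2)])
  then obtain d where "d > 0"
    "\<forall>z\<in>ball 0 1. 1 - (norm z)\<^sup>2 < d \<longrightarrow> 1 - (cnorm {..<N} (f z))\<^sup>2 < e" by blast
  then show ?thesis by (intro that[of d]) (simp_all add: mem_ball_0)
qed

section \<open>Homotopies through proper maps\<close>

lemma prod_topology_top_of_set: "prod_topology (top_of_set S) (top_of_set T) = top_of_set (S \<times> T)"
  by (metis prod_topology_euclidean subtopology_Times)

text \<open>Joint continuity is checked one coordinate at a time, which is what the product topology
  asks for; the coordinates from \<open>N\<close> on vanish because every \<open>H t\<close> is
  proper into C^N.\<close>

lemma homotopic_properI:
  fixes H :: "real \<Rightarrow> complex ^ 'n::finite \<Rightarrow> nat \<Rightarrow> complex"
  assumes cont: "\<And>i. i < N \<Longrightarrow> continuous_on ({0..1} \<times> ball 0 1) (\<lambda>x. H (fst x) (snd x) i)"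
    and proper: "\<And>t. 0 \<le> t \<Longrightarrow> t \<le> 1 \<Longrightarrow> proper_holomorphic N (H t)"
    and ends: "\<And>z. norm z < 1 \<Longrightarrow> H 0 z = f z" "\<And>z. norm z < 1 \<Longrightarrow> H 1 z = g z"
  shows "homotopic_proper N f g"
  unfolding homotopic_proper_def
proof (rule homotopic_with[THEN iffD2])
  fix h k :: "complex ^ 'n \<Rightarrow> nat \<Rightarrow> complex"
  assume "\<And>x. x \<in> topspace (top_of_set (ball 0 1)) \<Longrightarrow> h x = k x"
  then have "h z = k z" if "z \<in> ball 0 1" for z using that by simp
  then show "proper_holomorphic N h \<longleftrightarrow> proper_holomorphic N k"
    by (intro iffI; elim proper_holomorphic_cong) simp_all
next
  have mem: "H t z \<in> cspace N" if "t \<in> {0..1}" "z \<in> ball 0 1" for t z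
    using proper_holomorphic_cspace[OF proper] that by simp
  have "continuous_on ({0..1} \<times> ball 0 1) (\<lambda>x. H (fst x) (snd x))"
  proof (rule continuous_on_coordinatewise_then_product)
    fix i
    show "continuous_on ({0..1} \<times> ball 0 1) (\<lambda>x. H (fst x) (snd x) i)"
    proof (cases "i < N")
      case False
      then have "H (fst x) (snd x) i = 0" if "x \<in> {0..1} \<times> ball 0 1" for x
        using mem that by (auto simp: cspace_def)
      then show ?thesis by (metis (no_types, lifting) continuous_on_const continuous_on_cong)
    qed (rule cont)
  qed
  then show "\<exists>h. continuous_map (prod_topology (top_of_set {0..1::real}) (top_of_set (ball 0 1)))
      (top_of_set (cspace N)) h \<and>
    (\<forall>x\<in>topspace (top_of_set (ball 0 1)). h (0, x) = f x) \<and>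
    (\<forall>x\<in>topspace (top_of_set (ball 0 1)). h (1, x) = g x) \<and>
    (\<forall>t\<in>{0..1}. proper_holomorphic N (\<lambda>x. h (t, x)))"
    using mem ends proper
    by (intro exI[of _ "\<lambda>x. H (fst x) (snd x)"])
       (auto simp: continuous_map_in_subtopology prod_topology_top_of_set
         intro!: continuous_map_into_subtopology)
qed

lemma homotopic_properE:
  fixes f g :: "complex ^ 'n::finite \<Rightarrow> nat \<Rightarrow> complex"
  assumes "homotopic_proper N f g"
  obtains H :: "real \<Rightarrow> complex ^ 'n \<Rightarrow> nat \<Rightarrow> complex" where "\<And>i. continuous_on ({0..1} \<times> ball 0 1) (\<lambda>x. H (fst x) (snd x) i)"
    "\<And>t. 0 \<le> t \<Longrightarrow> t \<le> 1 \<Longrightarrow> proper_holomorphic N (H t)" "H 0 = f" "H 1 = g"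
proof -
  obtain h where h: "continuous_map (prod_topology (top_of_set {0..1::real}) (top_of_set (ball 0 1)))
      (top_of_set (cspace N)) h"
    "\<forall>x. h (0, x) = f x" "\<forall>x. h (1, x) = g x" "\<forall>t\<in>{0..1}. proper_holomorphic N (\<lambda>x. h (t, x))"
    using assms unfolding homotopic_proper_def homotopic_with_def by auto
  have "continuous_on ({0..1} \<times> ball 0 1) h"
    using h(1) by (simp add: continuous_map_in_subtopology prod_topology_top_of_set)
  then have "continuous_on ({0..1} \<times> ball 0 1) (\<lambda>x. h x i)" for i
    by (rule continuous_on_product_then_coordinatewise)
  then show ?thesis
    using h that[of "\<lambda>t z. h (t, z)"] by auto
qed

lemma homotopic_proper_sym: "homotopic_proper N f g \<Longrightarrow> homotopic_proper N g f"
  unfolding homotopic_proper_def by (rule homotopic_with_symD)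

lemma homotopic_proper_trans:
  "homotopic_proper N f g \<Longrightarrow> homotopic_proper N g h \<Longrightarrow> homotopic_proper N f h"
  unfolding homotopic_proper_def by (rule homotopic_with_trans)

lemma homotopic_proper_imp_proper:
  "homotopic_proper N f g \<Longrightarrow> proper_holomorphic N f \<and> proper_holomorphic N g"
  unfolding homotopic_proper_def using homotopic_with_imp_property by blast

text \<open>The constant homotopy. It replaces a map by one that is known to agree with it only on
  the ball, which is all that the definition of a Whitney sequence provides.\<close>

lemma homotopic_proper_eq:
  assumes "proper_holomorphic N f" "\<And>z. norm z < 1 \<Longrightarrow> f z = g z"
  shows "homotopic_proper N f g"
  by (rule homotopic_properI[where H = "\<lambda>_. f"])
    (use assms in \<open>simp_all add: proper_holomorphic_continuous_on_snd[OF assms(1)]\<close>)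

section \<open>Deforming unitary maps\<close>

text \<open>Linearity and preservation of the product are demanded on all functions, so rewriting
  with them has no membership side conditions; this is possible since \<open>hinner N\<close>
  ignores the coordinates from \<open>N\<close> on. On C^N itself such an isometry is onto for
  reasons of dimension.\<close>

definition unitary :: "nat \<Rightarrow> ((nat \<Rightarrow> complex) \<Rightarrow> nat \<Rightarrow> complex) \<Rightarrow> bool" where
  "unitary N T \<longleftrightarrow> (\<forall>v\<in>cspace N. T v \<in> cspace N) \<and> (\<forall>v w. T (v + w) = T v + T w) \<and>
     (\<forall>c v. T (cscale c v) = cscale c (T v)) \<and> (\<forall>v w. hinner N (T v) (T w) = hinner N v w)"

lemma unitary_cspace: "unitary N T \<Longrightarrow> v \<in> cspace N \<Longrightarrow> T v \<in> cspace N"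
  and unitary_add: "unitary N T \<Longrightarrow> T (v + w) = T v + T w"
  and unitary_scale: "unitary N T \<Longrightarrow> T (cscale c v) = cscale c (T v)"
  and unitary_hinner: "unitary N T \<Longrightarrow> hinner N (T v) (T w) = hinner N v w"
  by (auto simp: unitary_def)

lemma unitary_sum:
  assumes "unitary N T"
  shows "T (\<Sum>k\<in>K. f k) = (\<Sum>k\<in>K. T (f k))"
proof -
  have "T 0 = 0"
    using unitary_add[OF assms, of 0 0] by simp
  then show ?thesis
    by (induction K rule: infinite_finite_induct) (simp_all add: unitary_add[OF assms])
qed

lemma unitary_cnorm: "unitary N T \<Longrightarrow> cnorm {..<N} (T v) = cnorm {..<N} v"
  using unitary_hinner[of N T v v] 
  by (metis cip_self_norm cnorm_nonneg hinner_eq_cip power2_eq_iff_nonneg)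

lemma unitary_compose: "unitary N S \<Longrightarrow> unitary N T \<Longrightarrow> unitary N (S \<circ> T)"
  by (simp add: unitary_def)

lemma cspace_unit_vec_expansion:
  assumes "v \<in> cspace N"
  shows "v = (\<Sum>k<N. cscale (v k) (unit_vec k))"
proof -
  have "orthonormal N N (\<lambda>i. unit_vec (id i))" by (rule orthonormal_unit_vec) auto
  from orthonormal_expansion[OF this assms] show ?thesis
    by (simp add: hinner_unit_vec_right)
qed

text \<open>The components of \<open>T (f z)\<close> are combinations of those of \<open>f\<close>
  with the matrix entries of \<open>T\<close> as constants, and norms are unchanged, hence also the
  boundary behaviour.\<close>

lemma unitary_proper_holomorphic:
  fixes f :: "complex ^ 'n::finite \<Rightarrow> nat \<Rightarrow> complex"
  assumes T: "unitary N T" and f: "proper_holomorphic N f"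
  shows "proper_holomorphic N (\<lambda>z. T (f z))"
proof -
  have "mholomorphic_on (\<lambda>z. T (f z) i) (ball 0 1)" for i
  proof (rule mholomorphic_on_cong)
    show "mholomorphic_on (\<lambda>z. \<Sum>k<N. f z k * T (unit_vec k) i) (ball 0 1)"
      by (intro mholomorphic_on_sum mholomorphic_on_mult mholomorphic_on_const
          proper_holomorphic_mholomorphic_on[OF f]) auto
    fix z :: "complex ^ 'n" assume z: "z \<in> ball 0 1"
    show "(\<Sum>k<N. f z k * T (unit_vec k) i) = T (f z) i"
      by (subst (2) cspace_unit_vec_expansion[of "f z" N])
        (use z f in \<open>auto simp: unitary_sum[OF T] unitary_scale[OF T] sum_fun_apply proper_holomorphic_cspace\<close>)
  qed auto
  then show ?thesis
    using f unitary_cspace[OF T] by (simp add: proper_holomorphic_iff unitary_cnorm[OF T])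
qed

text \<open>The vector \<open>u\<close> is not normalised; for \<open>u = 0\<close> the map is the identity, since \<open>x / 0 = 0\<close>.\<close>

definition complex_reflection ::
  "nat \<Rightarrow> complex \<Rightarrow> (nat \<Rightarrow> complex) \<Rightarrow> (nat \<Rightarrow> complex) \<Rightarrow> nat \<Rightarrow> complex" where
  "complex_reflection N \<mu> u v = v + cscale ((\<mu> - 1) * hinner N v u / hinner N u u) u"

lemma unitary_complex_reflection:
  assumes "cmod \<mu> = 1" "u \<in> cspace N"
  shows "unitary N (complex_reflection N \<mu> u)"
  unfolding unitary_def complex_reflection_def
proof (intro conjI ballI allI)
  have \<mu>: "\<mu> * cnj \<mu> = 1" using assms(1) complex_norm_square[of \<mu>] by simp
  fix v w
  define q where "q = cip {..<N} u u"
  have q: "cnj q = q" by (simp add: q_def cip_self)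
  define s where "s = cip {..<N} v u"
  define t where "t = cip {..<N} w u"
  have ut: "cip {..<N} u w = cnj t" by (simp add: t_def cip_commute[of _ u w])
  show "hinner N (v + cscale ((\<mu> - 1) * hinner N v u / hinner N u u) u)
      (w + cscale ((\<mu> - 1) * hinner N w u / hinner N u u) u) = hinner N v w"
  \<comment> \<open>If q = 0, division by zero makes the correction term vanish. Otherwise all
    correction terms collect to a multiple of |\<mu>|^2 - 1.\<close>
  proof (cases "q = 0")
    case True
    then show ?thesis by (simp add: hinner_eq_cip q_def cip_simps)
  next
    case False
    have "hinner N (v + cscale ((\<mu> - 1) * hinner N v u / hinner N u u) u)
      (w + cscale ((\<mu> - 1) * hinner N w u / hinner N u u) u) =
      cip {..<N} v w + s * cnj t * (\<mu> * cnj \<mu> - 1) / q"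
      using False q by (simp add: hinner_eq_cip cip_simps ut flip: q_def s_def t_def)
        (simp add: field_simps)
    then show ?thesis by (simp add: \<mu> hinner_eq_cip)
  qed
next
  show "v + cscale ((\<mu> - 1) * hinner N v u / hinner N u u) u \<in> cspace N" if "v \<in> cspace N" for v
    by (intro cspace_add cspace_scale that assms(2))
qed (auto simp: hinner_eq_cip cip_simps fun_eq_iff field_simps add_divide_distrib diff_divide_distrib)

lemma homotopic_proper_complex_reflection:
  assumes f: "proper_holomorphic N f" and \<mu>: "cmod \<mu> = 1" and u: "u \<in> cspace N"
  shows "homotopic_proper N f (\<lambda>z. complex_reflection N \<mu> u (f z))"
proof (rule homotopic_properI[where H = "\<lambda>t z. complex_reflection N (cis (t * Arg \<mu>)) u (f z)"])
  have f': "continuous_on ({0..1} \<times> ball 0 1) (\<lambda>x. f (snd x) i)" for i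
    by (rule proper_holomorphic_continuous_on_snd[OF f])
  show "continuous_on ({0..1} \<times> ball 0 1)
      (\<lambda>x. complex_reflection N (cis (fst x * Arg \<mu>)) u (f (snd x)) i)" for i
  proof -
    \<comment> \<open>The reciprocal is a constant, including the case \<open>u = 0\<close>; naming
      it keeps the continuity rules from asking for a non-zero denominator.\<close>
    define q where "q = inverse (hinner N u u)"
    show ?thesis
      unfolding complex_reflection_def plus_fun_apply cscale_apply divide_inverse
      unfolding q_def[symmetric] hinner_def
      by (intro continuous_on_add continuous_on_mult continuous_on_diff continuous_on_sum
          continuous_on_const continuous_on_cis continuous_on_fst continuous_on_id f')
  qed
  show "proper_holomorphic N (\<lambda>z. complex_reflection N (cis (t * Arg \<mu>)) u (f z))" for t
    by (rule unitary_proper_holomorphic[OF unitary_complex_reflection[OF _ u] f]) simp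
  have "cis (Arg \<mu>) = \<mu>" using \<mu> by (metis cis_Arg norm_zero sgn_eq scaleR_one div_by_1 of_real_1 zero_neq_one)
  then show "complex_reflection N (cis (1 * Arg \<mu>)) u (f z) = complex_reflection N \<mu> u (f z)" for z
    by simp
qed (simp add: complex_reflection_def fun_eq_iff)

text \<open>The eigenvector is \<open>x - y\<close>, as for the real reflection exchanging two unit
  vectors. Over the complex numbers the eigenvalue must be adjusted to the phase of the product of
  \<open>x\<close> and \<open>y\<close>; it is -1 when that product is real and
  \<open>x \<noteq> y\<close>.\<close>

lemma complex_reflection_moves:
  assumes x: "x \<in> cspace N" "hinner N x x = 1" and y: "y \<in> cspace N" "hinner N y y = 1"
  obtains \<mu> where "cmod \<mu> = 1" "complex_reflection N \<mu> (x - y) x = y"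
proof (cases "x = y")
  case True
  then show ?thesis using that[of 1] by (simp add: complex_reflection_def fun_eq_iff)
next
  case False
  define s where "s = hinner N x (x - y)"
  have s: "s = 1 - hinner N x y" using x by (simp add: s_def hinner_eq_cip cip_simps)
  have q: "hinner N (x - y) (x - y) = s + cnj s"
    using x y cip_commute[of "{..<N}" y x] by (simp add: s hinner_eq_cip cip_simps)
  have q0: "s + cnj s \<noteq> 0"
  proof
    assume "s + cnj s = 0"
    then have "x - y = 0" using x y q by (intro cspace_eq_0[of _ N] cspace_diff) simp_all
    then show False using False by simp
  qed
  then have s0: "s \<noteq> 0" by auto
  \<comment> \<open>The solution of (\<mu> - 1) s / (s + cnj s) = -1, the condition for the
    reflection to subtract exactly \<open>x - y\<close> from \<open>x\<close>.\<close>
  define \<mu> where "\<mu> = - cnj s / s"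
  have "cmod \<mu> = 1" using s0 by (simp add: \<mu>_def norm_divide)
  moreover have "(\<mu> - 1) * s / (s + cnj s) = -1"
    using s0 q0 by (simp add: \<mu>_def divide_simps)
  then have "complex_reflection N \<mu> (x - y) x = y"
    by (simp add: complex_reflection_def q fun_eq_iff flip: s_def)
  ultimately show ?thesis using that by blast
qed

text \<open>The unitary map is a product of complex reflections, one for each vector, where the later
  ones fix the vectors that are already in place. A complex reflection can be deformed to the
  identity by moving its eigenvalue along the unit circle.\<close>

lemma unitary_moves_orthonormal:
  assumes "orthonormal N d a" "orthonormal N d b"
  shows "\<exists>T. unitary N T \<and> (\<forall>i<d. T (a i) = b i) \<and>
     (\<forall>f :: complex ^ 'n::finite \<Rightarrow> nat \<Rightarrow> complex.
        proper_holomorphic N f \<longrightarrow> homotopic_proper N f (\<lambda>z. T (f z)))"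
  using assms
proof (induction d)
  case 0
  show ?case
    by (intro exI[of _ "\<lambda>v. v"]) (auto simp: unitary_def intro: homotopic_proper_eq)
next
  case (Suc d)
  obtain T where T: "unitary N T" "\<And>i. i < d \<Longrightarrow> T (a i) = b i"
    and hT: "\<And>f :: complex ^ 'n::finite \<Rightarrow> nat \<Rightarrow> complex.
        proper_holomorphic N f \<Longrightarrow> homotopic_proper N f (\<lambda>z. T (f z))"
    using Suc.IH Suc.prems orthonormal_less[of N "Suc d" _ d] by auto
  define x where "x = T (a d)"
  define y where "y = b d"
  have ad: "a d \<in> cspace N" using orthonormal_cspace[OF Suc.prems(1)] by simp
  have x: "x \<in> cspace N" "hinner N x x = 1"
    unfolding x_def unitary_hinner[OF T(1)]
    using unitary_cspace[OF T(1) ad] orthonormal_cip[OF Suc.prems(1)] by (auto simp: hinner_eq_cip)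
  have y: "y \<in> cspace N" "hinner N y y = 1"
    unfolding y_def using orthonormal_cspace[OF Suc.prems(2)] orthonormal_cip[OF Suc.prems(2)]
    by (auto simp: hinner_eq_cip)
  obtain \<mu> where \<mu>: "cmod \<mu> = 1" "complex_reflection N \<mu> (x - y) x = y"
    using complex_reflection_moves[OF x y] by blast
  let ?R = "complex_reflection N \<mu> (x - y)"
  have R: "unitary N ?R" using \<mu> x y by (intro unitary_complex_reflection cspace_diff)
  \<comment> \<open>Since \<open>T\<close> is unitary, \<open>x\<close> is orthogonal to
    \<open>T (a i) = b i\<close>; so is \<open>y\<close>. Hence \<open>b i\<close> is orthogonal to
    the eigenvector \<open>x - y\<close>.\<close>
  have fix_b: "?R (b i) = b i" if "i < d" for i
  proof -
    have "hinner N (b i) x = hinner N (a i) (a d)"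
      using T(2)[OF that] unitary_hinner[OF T(1), of "a i" "a d"] by (simp add: x_def)
    also have "\<dots> = 0" using that orthonormal_cip[OF Suc.prems(1), of i d] by (simp add: hinner_eq_cip)
    finally have "hinner N (b i) x = 0" .
    moreover have "hinner N (b i) y = 0"
      using that orthonormal_cip[OF Suc.prems(2), of i d] by (simp add: hinner_eq_cip y_def)
    ultimately have "hinner N (b i) (x - y) = 0" by (simp add: hinner_eq_cip cip_diff_right)
    then show ?thesis by (simp add: complex_reflection_def fun_eq_iff)
  qed
  show ?case
  proof (intro exI[of _ "?R \<circ> T"] conjI allI impI)
    show "unitary N (?R \<circ> T)" by (rule unitary_compose[OF R T(1)])
    show "(?R \<circ> T) (a i) = b i" if "i < Suc d" for i
      using that fix_b T(2) \<mu>(2) by (auto simp: less_Suc_eq x_def y_def)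
    fix f :: "complex ^ 'n \<Rightarrow> nat \<Rightarrow> complex"
    assume f: "proper_holomorphic N f"
    have "homotopic_proper N (\<lambda>z. T (f z)) (\<lambda>z. ?R (T (f z)))"
      by (rule homotopic_proper_complex_reflection[OF unitary_proper_holomorphic[OF T(1) f] \<mu>(1)
            cspace_diff[OF x(1) y(1)]])
    from homotopic_proper_trans[OF hT[OF f] this]
    show "homotopic_proper N f (\<lambda>z. (?R \<circ> T) (f z))" by simp
  qed
qed

section \<open>Automorphisms of the ball\<close>

lemma norm_eq_cnorm: "norm z = cnorm UNIV (($) z)"
  by (simp add: norm_vec_def cnorm_def)

definition vip :: "complex ^ 'n::finite \<Rightarrow> complex ^ 'n \<Rightarrow> complex" where
  "vip z w = cip UNIV (($) z) (($) w)"

lemma vip_diff_left: "vip (u - v) w = vip u w - vip v w"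
  and vip_diff_right: "vip u (v - w) = vip u v - vip u w"
  and vip_scale_left: "vip (c *s u) w = c * vip u w"
  and vip_scale_right: "vip u (c *s w) = cnj c * vip u w"
  by (simp_all add: vip_def cip_def algebra_simps sum.distrib sum_subtractf sum_distrib_left)

lemma vip_commute: "vip w v = cnj (vip v w)"
  unfolding vip_def by (rule cip_commute)

lemma vip_self: "vip z z = of_real ((norm z)\<^sup>2)"
  by (simp add: vip_def norm_eq_cnorm cip_self)

lemma norm_vip_le: "cmod (vip z w) \<le> norm z * norm w"
  unfolding vip_def norm_eq_cnorm by (rule norm_cip_le)

lemma norm_vector_scale: "norm (c *s z) = cmod c * norm z" for z :: "complex ^ 'n::finite"
  using cnorm_scale[of UNIV c "($) z"] unfolding norm_eq_cnorm cscale_def vector_smult_component[abs_def, symmetric] .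

lemma bounded_linear_scale_vector: "bounded_linear (\<lambda>c. c *s z)" for z :: "complex ^ 'n::finite"
  by (intro linear_conv_bounded_linear[THEN iffD1] linearI) (simp_all add: vec_eq_iff algebra_simps)

lemma mholomorphic_on_compose:
  fixes f :: "complex ^ 'm::finite \<Rightarrow> complex" and g :: "complex ^ 'n::finite \<Rightarrow> complex ^ 'm"
  assumes f: "mholomorphic_on f S" and g: "\<And>l. mholomorphic_on (\<lambda>z. g z $ l) T" "g ` T \<subseteq> S"
  shows "mholomorphic_on (\<lambda>z. f (g z)) T"
  unfolding mholomorphic_on_def
proof
  fix z assume z: "z \<in> T"
  then have "\<forall>l. \<exists>D. ((\<lambda>z. g z $ l) has_derivative D) (at z) \<and> (\<forall>c v. D (c *s v) = c * D v)"
    using g(1) by (simp add: mholomorphic_on_def)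
  then obtain D where D: "\<And>l. ((\<lambda>z. g z $ l) has_derivative D l) (at z)"
    "\<And>l c v. D l (c *s v) = c * D l v"
    by metis
  \<comment> \<open>Expansion along the coordinate axes assembles the derivatives of the components
    of \<open>g\<close> into a derivative of \<open>g\<close>.\<close>
  have "((\<lambda>z. \<Sum>l\<in>UNIV. (g z $ l) *s axis l 1) has_derivative (\<lambda>v. \<Sum>l\<in>UNIV. D l v *s axis l 1)) (at z)"
    by (intro has_derivative_sum bounded_linear.has_derivative[OF bounded_linear_scale_vector] D(1))
  moreover have "(\<Sum>l\<in>UNIV. D l v *s axis l 1) = (\<chi> l. D l v)" for v
    using basis_expansion[of "\<chi> l. D l v"] by simp
  ultimately have g': "(g has_derivative (\<lambda>v. \<chi> l. D l v)) (at z)"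
    by (simp add: basis_expansion)
  have "g z \<in> S" using z g(2) by auto
  then obtain L where L: "(f has_derivative L) (at (g z))" "\<And>c v. L (c *s v) = c * L v"
    using f by (auto simp: mholomorphic_on_def)
  have "(\<chi> l. D l (c *s v)) = c *s (\<chi> l. D l v)" for c v by (simp add: vec_eq_iff D(2))
  then show "\<exists>L. ((\<lambda>z. f (g z)) has_derivative L) (at z) \<and> (\<forall>c v. L (c *s v) = c * L v)"
    using has_derivative_compose[OF g' L(1)] L(2)
    by (intro exI[of _ "\<lambda>v. L (\<chi> l. D l v)"]) simp
qed

text \<open>By complex linearity the derivative along the disc through \<open>z\<close> is
  multiplication by the number \<open>L z\<close>.\<close>

lemma mholomorphic_on_slice:
  assumes f: "mholomorphic_on f (ball 0 1)" and z: "norm z = 1"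
  shows "(\<lambda>c. f (c *s z)) holomorphic_on ball 0 1"
  unfolding holomorphic_on_open[OF open_ball]
proof
  fix c :: complex assume "c \<in> ball 0 1"
  then have "c *s z \<in> ball 0 1" using z by (simp add: norm_vector_scale)
  then obtain L where L: "(f has_derivative L) (at (c *s z))" "\<forall>c v. L (c *s v) = c * L v"
    using f unfolding mholomorphic_on_def by blast
  have "((\<lambda>c. f (c *s z)) has_derivative (\<lambda>h. L (h *s z))) (at c)"
    by (rule has_derivative_compose[OF bounded_linear_imp_has_derivative[OF bounded_linear_scale_vector] L(1)])
  moreover have "(\<lambda>h. L (h *s z)) = (*) (L z)" by (simp add: fun_eq_iff L(2) mult.commute)
  ultimately have "((\<lambda>c. f (c *s z)) has_field_derivative L z) (at c)"
    by (simp only: has_field_derivative_def)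
  then show "\<exists>f'. ((\<lambda>c. f (c *s z)) has_field_derivative f') (at c)" by blast
qed

section \<open>The Schwarz lemma on the ball\<close>

definition ball_holomorphic :: "(complex ^ 'n::finite \<Rightarrow> complex ^ 'n) \<Rightarrow> bool" where
  "ball_holomorphic L \<longleftrightarrow> L ` ball 0 1 \<subseteq> ball 0 1 \<and> (\<forall>l. mholomorphic_on (\<lambda>z. L z $ l) (ball 0 1))"

lemma ball_holomorphic_norm: "ball_holomorphic L \<Longrightarrow> norm z < 1 \<Longrightarrow> norm (L z) < 1"
  by (auto simp: ball_holomorphic_def image_subset_iff)

text \<open>These are the hypotheses of the one-variable Schwarz lemma. Pairing with a unit vector
  \<open>w\<close> keeps the values in the disc by the Cauchy-Schwarz inequality.\<close>

lemma ball_holomorphic_slice: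
  assumes L: "ball_holomorphic L" "L 0 = 0" and z: "norm z = 1" and w: "norm w = 1"
  defines "g \<equiv> \<lambda>c. vip (L (c *s z)) w"
  shows "g holomorphic_on ball 0 1" "g 0 = 0" "\<And>c. norm c < 1 \<Longrightarrow> norm (g c) < 1"
proof -
  show "g holomorphic_on ball 0 1"
    unfolding g_def vip_def cip_def
    by (intro holomorphic_intros mholomorphic_on_slice[OF _ z])
       (use L in \<open>simp add: ball_holomorphic_def\<close>)
  show "g 0 = 0" by (simp add: g_def vip_def cip_def L)
  show "norm (g c) < 1" if "norm c < 1" for c
    using norm_vip_le[of "L (c *s z)" w] ball_holomorphic_norm[OF L(1), of "c *s z"] that
    by (simp add: g_def norm_vector_scale z w)
qed

lemma norm_axis_one: "norm (axis l (1 :: complex)) = 1"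
  by (simp add: norm_vec_def L2_set_def axis_def if_distrib[of norm] if_distrib[of "\<lambda>x. x\<^sup>2"] cong: if_cong)

text \<open>Polar form; for \<open>z = 0\<close> an arbitrary axis vector serves as
  direction.\<close>

lemma unit_multiple:
  fixes z :: "complex ^ 'n::finite"
  obtains w where "norm w = 1" "z = of_real (norm z) *s w"
proof (cases "z = 0")
  case True
  then show ?thesis
    using that[of "axis undefined 1"] by (simp add: norm_axis_one)
next
  case False
  then show ?thesis
    using that[of "of_real (1 / norm z) *s z"] by (simp add: norm_vector_scale norm_divide vec_eq_iff)
qed

text \<open>The one-variable lemma on the disc through \<open>z\<close>, with \<open>L\<close>
  paired with the direction of \<open>L z\<close>, so that at \<open>z\<close> the pairing returns
  the full norm.\<close>

lemma schwarz_ball: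
  assumes L: "ball_holomorphic L" "L 0 = 0" and z: "norm z < 1"
  shows "norm (L z) \<le> norm z"
proof -
  obtain u where u: "norm u = 1" "z = of_real (norm z) *s u" by (rule unit_multiple)
  obtain w where w: "norm w = 1" "L z = of_real (norm (L z)) *s w" by (rule unit_multiple)
  note g = ball_holomorphic_slice[OF L u(1) w(1)]
  have "cmod (vip (L (of_real (norm z) *s u)) w) \<le> cmod (of_real (norm z))"
    by (rule Schwarz_Lemma(1)[OF g]) (use z in simp_all)
  also have "L (of_real (norm z) *s u) = L z" using u(2) by simp
  also have "vip (L z) w = of_real (norm (L z))"
    by (subst w(2)) (simp add: vip_scale_left vip_self w(1))
  finally show ?thesis by simp
qed

text \<open>Equality in the one-variable Schwarz lemma on the disc through \<open>z\<close>.\<close>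

lemma schwarz_ball_eq:
  assumes L: "ball_holomorphic L" "L 0 = 0" and z: "norm z < 1" and eq: "norm (L z) = norm z"
    and c: "norm (c *s z) < 1"
  shows "L (c *s z) = c *s L z"
proof (cases "z = 0")
  case True
  then show ?thesis using L by simp
next
  case False
  obtain u where u: "norm u = 1" "z = of_real (norm z) *s u" by (rule unit_multiple)
  obtain w where w: "norm w = 1" "L z = of_real (norm (L z)) *s w" by (rule unit_multiple)
  have vw: "vip (L z) w = of_real (norm z)"
    by (subst w(2)) (simp add: vip_scale_left vip_self w(1) eq)
  define g where "g c = vip (L (c *s u)) w" for c
  have gz: "g (of_real (norm z)) = of_real (norm z)"
    using vw u(2) by (simp add: g_def)
  note g = ball_holomorphic_slice[OF L u(1) w(1), folded g_def]
  have "\<exists>\<alpha>. (\<forall>z. norm z < 1 \<longrightarrow> g z = \<alpha> * z) \<and> norm \<alpha> = 1"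
    by (rule Schwarz_Lemma(3)[OF g, of 0])
       (use gz z False in \<open>auto intro!: exI[of _ "of_real (norm z)"]\<close>)
  then obtain \<alpha> where \<alpha>: "\<And>z. norm z < 1 \<Longrightarrow> g z = \<alpha> * z" by blast
  \<comment> \<open>The slice function fixes the non-zero number \<open>norm z\<close>, which rules
    out any other rotation.\<close>
  have "\<alpha> = 1" using \<alpha>[of "of_real (norm z)"] gz z False by simp
  define b where "b = c * of_real (norm z)"
  have "c *s z = c *s (of_real (norm z) *s u)" using u(2) by simp
  then have bu: "b *s u = c *s z" by (simp only: b_def vector_smult_assoc)
  have b: "norm b < 1" using c by (simp add: b_def norm_vector_scale norm_mult)
  have gb: "vip (L (c *s z)) w = b" using \<alpha>[OF b] \<open>\<alpha> = 1\<close> by (simp add: g_def bu)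
  \<comment> \<open>The component of \<open>L (c *s z)\<close> along \<open>w\<close> is
    \<open>b\<close>, and the whole vector is no longer than that, so no orthogonal component
    remains.\<close>
  have "norm (L (c *s z)) \<le> norm b"
    using schwarz_ball[OF L c] by (simp add: b_def norm_vector_scale norm_mult)
  then have "(norm (L (c *s z)))\<^sup>2 \<le> (norm b)\<^sup>2" by (intro power_mono) auto
  moreover have "vip (L (c *s z) - b *s w) (L (c *s z) - b *s w) =
      of_real ((norm (L (c *s z)))\<^sup>2 - (norm b)\<^sup>2)"
    using gb vip_commute[of w "L (c *s z)"] complex_norm_square[of b]
    unfolding vip_diff_left vip_diff_right vip_scale_left vip_scale_right
    by (simp add: vip_self w(1) algebra_simps)
  then have "(norm (L (c *s z) - b *s w))\<^sup>2 = (norm (L (c *s z)))\<^sup>2 - (norm b)\<^sup>2"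
    unfolding vip_self of_real_eq_iff .
  ultimately have "(norm (L (c *s z) - b *s w))\<^sup>2 \<le> 0" by simp
  then have "L (c *s z) = b *s w" by simp
  also have "b *s w = c *s L z"
    by (subst w(2)) (simp add: b_def eq vec_eq_iff)
  finally show ?thesis .
qed

text \<open>\<Lambda> is the derivative of \<open>L\<close> at 0, which supplies additivity. On the
  disc through \<open>z\<close> the equality case makes \<open>L\<close> the map c -> c L(z), so the
  derivative in the direction \<open>z\<close> is \<open>L z\<close>.\<close>

lemma norm_preserving_linear:
  assumes L: "ball_holomorphic L" "L 0 = 0" and eq: "\<And>z. norm z < 1 \<Longrightarrow> norm (L z) = norm z"
  shows "\<exists>\<Lambda>. (\<forall>z. norm z < 1 \<longrightarrow> L z = \<Lambda> z) \<and> (\<forall>v w. \<Lambda> (v + w) = \<Lambda> v + \<Lambda> w) \<and>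
    (\<forall>c v. \<Lambda> (c *s v) = c *s \<Lambda> v) \<and> (\<forall>v. norm (\<Lambda> v) = norm v)"
proof -
  have "\<exists>D. ((\<lambda>z. L z $ l) has_derivative D) (at 0) \<and> (\<forall>c v. D (c *s v) = c * D v)" for l
    using L(1) by (auto simp: ball_holomorphic_def mholomorphic_on_def)
  then obtain D where D: "\<And>l. ((\<lambda>z. L z $ l) has_derivative D l) (at 0)"
    "\<And>l c v. D l (c *s v) = c * D l v"
    by metis
  define \<Lambda> where "\<Lambda> v = (\<chi> l. D l v)" for v
  have scale: "\<Lambda> (c *s v) = c *s \<Lambda> v" for c v by (simp add: \<Lambda>_def D(2) vec_eq_iff)
  have add: "\<Lambda> (v + w) = \<Lambda> v + \<Lambda> w" for v w
    by (simp add: \<Lambda>_def vec_eq_iff linear_add[OF has_derivative_linear[OF D(1)]])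
  have L\<Lambda>: "L z = \<Lambda> z" if z: "norm z < 1" for z
  proof -
    have "D l z = L z $ l" for l
    proof -
      have D0: "((\<lambda>z. L z $ l) has_derivative D l) (at (0 *s z))" using D(1) by simp
      have "((\<lambda>c. L (c *s z) $ l) has_derivative (\<lambda>h. D l (h *s z))) (at 0)"
        by (rule has_derivative_compose[OF bounded_linear_imp_has_derivative[OF bounded_linear_scale_vector] D0])
      moreover have "(\<lambda>h. D l (h *s z)) = (*) (D l z)" by (simp add: fun_eq_iff D(2) mult.commute)
      ultimately have 1: "((\<lambda>c. L (c *s z) $ l) has_field_derivative D l z) (at 0)"
        by (simp only: has_field_derivative_def)
      have "((\<lambda>c. c * L z $ l) has_field_derivative L z $ l) (at 0)"
        by (auto intro!: derivative_eq_intros)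
      then have 2: "((\<lambda>c. L (c *s z) $ l) has_field_derivative L z $ l) (at 0)"
      proof (rule has_field_derivative_transform_within_open[of _ _ _ "ball 0 1"])
        fix c :: complex assume "c \<in> ball 0 1"
        then have "norm (c *s z) < 1"
          using z mult_strict_mono'[of "norm c" 1 "norm z" 1] by (simp add: norm_vector_scale)
        then show "c * L z $ l = L (c *s z) $ l"
          using schwarz_ball_eq[OF L z eq[OF z]] by simp
      qed auto
      show ?thesis by (rule DERIV_unique[OF 1 2])
    qed
    then show ?thesis by (simp add: \<Lambda>_def vec_eq_iff)
  qed
  have "norm (\<Lambda> v) = norm v" for v
  proof -
    \<comment> \<open>Scales \<open>v\<close> into the open ball, where \<open>L\<close> and
      \<Lambda> agree; homogeneity carries the norm identity back.\<close>
    define r where "r = 1 / (1 + norm v)"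
    have r: "r > 0" "r * norm v < 1" by (auto simp: r_def divide_simps add_pos_nonneg)
    have "norm (of_real r *s v) < 1" using r by (simp add: norm_vector_scale)
    then have "norm (\<Lambda> (of_real r *s v)) = norm (of_real r *s v)"
      using eq L\<Lambda> by metis
    then show ?thesis using r by (simp add: scale norm_vector_scale)
  qed
  then show ?thesis using L\<Lambda> scale add by blast
qed

text \<open>The involutive automorphism of the ball that exchanges \<open>0\<close> and \<open>a\<close>. The usual formula
  \<open>(a - P z - s Q z) / (1 - \<langle>z, a\<rangle>)\<close>, with the projections \<open>P\<close> and \<open>Q\<close> onto the line of \<open>a\<close> and its
  complement, is rewritten by \<open>(1 - s) / |a|\<^sup>2 = 1 / (1 + s)\<close>, which makes it continuous at \<open>a = 0\<close>.\<close>

definition ball_involution :: "complex ^ 'n::finite \<Rightarrow> complex ^ 'n \<Rightarrow> complex ^ 'n" where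
  "ball_involution a z = (let s = of_real (sqrt (1 - (norm a)\<^sup>2)) in
     inverse (1 - vip z a) *s ((1 - vip z a / (1 + s)) *s a - s *s z))"

context
  fixes a :: "complex ^ 'n::finite" and s :: complex
  assumes a: "norm a < 1"
  defines "s \<equiv> of_real (sqrt (1 - (norm a)\<^sup>2))"
begin

lemma ball_involution_s: "s\<^sup>2 = 1 - vip a a" "1 + s \<noteq> 0" "cnj s = s" "s \<noteq> 0"
proof -
  have a2: "(norm a)\<^sup>2 < 1" using a by (simp add: abs_square_less_1)
  then show "s\<^sup>2 = 1 - vip a a" by (simp add: s_def vip_self flip: of_real_power)
  show "s \<noteq> 0" using a2 by (simp add: s_def)
  have "1 + sqrt (1 - (norm a)\<^sup>2) > 0" using a2 by (simp add: add_pos_nonneg)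
  then show "1 + s \<noteq> 0" unfolding s_def
    by (metis of_real_1 of_real_add of_real_eq_0_iff less_irrefl)
  show "cnj s = s" by (simp add: s_def)
qed

lemma ball_involution_denom: "norm z < 1 \<Longrightarrow> 1 - vip z a \<noteq> 0"
  using norm_vip_le[of z a] a mult_strict_mono'[of "norm z" 1 "norm a" 1] by auto

text \<open>The classical defect identity. It shows that the ball is mapped into itself and later
  yields the bound behind properness.\<close>

lemma ball_involution_norm:
  assumes z: "norm z < 1"
  shows "1 - (norm (ball_involution a z))\<^sup>2 = (1 - (norm a)\<^sup>2) * (1 - (norm z)\<^sup>2) / (cmod (1 - vip z a))\<^sup>2"
proof -
  \<comment> \<open>Absorbs the division by 1 + s; with <a, a> = 1 - s^2 the numerator identity
    becomes polynomial in \<open>y\<close>, its conjugate, \<open>s\<close> and <z, z>.\<close>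
  define y where "y = vip z a / (1 + s)"
  have x: "vip z a = (1 + s) * y" "vip a z = (1 + s) * cnj y"
    using ball_involution_s(2,3) vip_commute[of a z] by (auto simp: y_def)
  have aa: "vip a a = 1 - s\<^sup>2" using ball_involution_s(1) by simp
  define N where "N = (1 - y) *s a - s *s z"
  have "vip N N = (1 - (1 + s) * y) * cnj (1 - (1 + s) * y) - s\<^sup>2 * (1 - vip z z)"
    by (simp add: N_def vip_diff_left vip_diff_right vip_scale_left vip_scale_right x aa ball_involution_s(3))
       (simp add: algebra_simps power2_eq_square)
  also have "\<dots> = of_real ((cmod (1 - vip z a))\<^sup>2 - (1 - (norm a)\<^sup>2) * (1 - (norm z)\<^sup>2))"
    by (simp add: ball_involution_s(1) vip_self complex_norm_square x del: of_real_power)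
  finally have N: "(norm N)\<^sup>2 = (cmod (1 - vip z a))\<^sup>2 - (1 - (norm a)\<^sup>2) * (1 - (norm z)\<^sup>2)"
    unfolding vip_self of_real_eq_iff .
  have "ball_involution a z = inverse (1 - vip z a) *s N"
    by (simp add: ball_involution_def Let_def N_def y_def flip: s_def)
  then have "(norm (ball_involution a z))\<^sup>2 = (norm N)\<^sup>2 / (cmod (1 - vip z a))\<^sup>2"
    by (simp add: norm_vector_scale norm_inverse power_mult_distrib divide_inverse power_inverse)
  then show ?thesis
    using ball_involution_denom[OF z] by (simp add: N field_simps)
qed

lemma ball_involution_in_ball: "norm z < 1 \<Longrightarrow> norm (ball_involution a z) < 1"
proof -
  assume z: "norm z < 1"
  then have "1 - (norm (ball_involution a z))\<^sup>2 > 0"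
    using ball_involution_norm[OF z] ball_involution_denom[OF z] a by (simp add: abs_square_less_1)
  then show ?thesis by (simp add: abs_square_less_1)
qed

text \<open>For the image \<open>m\<close> the role of \<open>y\<close> is taken by (1 - s - y) / D
  and the denominator becomes s^2 / D; in the new numerator the coefficient of \<open>a\<close>
  cancels and (s^2 / D) z is left.\<close>

lemma ball_involution_involution:
  assumes z: "norm z < 1"
  shows "ball_involution a (ball_involution a z) = z"
proof -
  define y where "y = vip z a / (1 + s)"
  have x: "vip z a = (1 + s) * y" using ball_involution_s(2) by (simp add: y_def)
  have aa: "vip a a = 1 - s\<^sup>2" using ball_involution_s(1) by simp
  define D where "D = 1 - (1 + s) * y"
  have D: "D \<noteq> 0" using ball_involution_denom[OF z] by (simp add: D_def x)
  define m where "m = ball_involution a z"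
  have m: "m = inverse D *s ((1 - y) *s a - s *s z)"
    unfolding m_def ball_involution_def Let_def s_def[symmetric] y_def[symmetric] D_def x
    using ball_involution_s(2) by simp
  have "vip m a = inverse D * ((1 - y) * (1 - s\<^sup>2) - s * ((1 + s) * y))"
    by (simp only: m vip_scale_left vip_diff_left x aa)
  also have "\<dots> = (1 + s) * (inverse D * (1 - s - y))"
    by (simp add: algebra_simps power2_eq_square)
  finally have xm: "vip m a = (1 + s) * (inverse D * (1 - s - y))" .
  then have ym: "vip m a / (1 + s) = inverse D * (1 - s - y)" using ball_involution_s(2) by simp
  have dm: "1 - vip m a = inverse D * s\<^sup>2"
    using D by (simp add: xm field_simps) (simp add: D_def algebra_simps power2_eq_square)
  have "((1 - vip m a / (1 + s)) *s a - s *s m) $ l = inverse D * s\<^sup>2 * z $ l" for l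
  proof -
    have "((1 - vip m a / (1 + s)) *s a - s *s m) $ l =
        inverse D * (D - (1 - s - y) - s * (1 - y)) * a $ l + inverse D * s\<^sup>2 * z $ l"
      unfolding ym using D by (simp add: m field_simps power2_eq_square)
    also have "D - (1 - s - y) - s * (1 - y) = 0" by (simp add: D_def algebra_simps)
    finally show ?thesis by simp
  qed
  then have vec: "(1 - vip m a / (1 + s)) *s a - s *s m = (inverse D * s\<^sup>2) *s z"
    by (simp only: vec_eq_iff vector_smult_component simp_thms)
  have "ball_involution a m = inverse (1 - vip m a) *s ((1 - vip m a / (1 + s)) *s a - s *s m)"
    by (simp add: ball_involution_def Let_def flip: s_def)
  then show ?thesis
    using D ball_involution_s(4) unfolding m_def[symmetric] vec dm vector_smult_assoc
    by (simp add: field_simps)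
qed

lemma ball_involution_self: "ball_involution a a = 0"
proof -
  have "1 - vip a a / (1 + s) = s"
    using ball_involution_s(1,2) by (simp add: field_simps power2_eq_square)
  then show ?thesis unfolding ball_involution_def Let_def s_def[symmetric] by (simp only: diff_self vector_smult_rzero)
qed

lemma ball_involution_mholomorphic:
  assumes f: "ball_holomorphic f"
  shows "ball_holomorphic (\<lambda>z. ball_involution a (f z))"
proof -
  have f': "mholomorphic_on (\<lambda>z. f z $ l) (ball 0 1)" for l
    using f by (simp add: ball_holomorphic_def)
  have v: "mholomorphic_on (\<lambda>z. vip (f z) a) (ball 0 1)"
    unfolding vip_def cip_def by (intro mholomorphic_on_sum mholomorphic_on_mult f' mholomorphic_on_const)
  have "mholomorphic_on (\<lambda>z. ball_involution a (f z) $ l) (ball 0 1)" for l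
    using ball_involution_denom[OF ball_holomorphic_norm[OF f]]
    unfolding ball_involution_def Let_def s_def[symmetric] divide_inverse vector_smult_component vector_minus_component
    by (intro mholomorphic_on_mult mholomorphic_on_diff mholomorphic_on_inverse mholomorphic_on_const v f')
      auto
  then show ?thesis
    using ball_involution_in_ball[OF ball_holomorphic_norm[OF f]]
    by (simp add: ball_holomorphic_def image_subset_iff)
qed

end

text \<open>The identification used for the first map of a Whitney sequence. It turns self-maps of
  the source ball into maps to C^N with N = \<open>CARD('n)\<close>, to which
  \<open>homotopic_proper\<close> and the unitary maps apply.\<close>

definition coord_embed :: "(nat \<Rightarrow> 'n) \<Rightarrow> complex ^ 'n::finite \<Rightarrow> nat \<Rightarrow> complex" where
  "coord_embed e w = (\<lambda>i. if i < CARD('n) then w $ e i else 0)"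

context
  fixes e :: "nat \<Rightarrow> 'n::finite"
  assumes e: "bij_betw e {..<CARD('n)} UNIV"
begin

lemma hinner_coord_embed: "hinner CARD('n) (coord_embed e v) (coord_embed e w) = vip v w"
  using sum.reindex_bij_betw[OF e, of "\<lambda>l. v $ l * cnj (w $ l)"]
  by (simp add: hinner_def coord_embed_def vip_def cip_def)

lemma cnorm_coord_embed: "cnorm {..<CARD('n)} (coord_embed e v) = norm v"
proof -
  have "of_real ((cnorm {..<CARD('n)} (coord_embed e v))\<^sup>2) = (of_real ((norm v)\<^sup>2) :: complex)"
    using hinner_coord_embed[of v v] by (simp only: hinner_eq_cip cip_self vip_self)
  then have "(cnorm {..<CARD('n)} (coord_embed e v))\<^sup>2 = (norm v)\<^sup>2"
    by (simp only: of_real_eq_iff)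
  then show ?thesis by (simp add: power2_eq_iff_nonneg)
qed

lemma coord_embed_cspace: "coord_embed e v \<in> cspace CARD('n)"
  by (simp add: coord_embed_def cspace_def)

lemma coord_embed_axis: "i < CARD('n) \<Longrightarrow> coord_embed e (axis (e i) 1) = unit_vec i"
  using bij_betw_imp_inj_on[OF e] by (auto simp: coord_embed_def unit_vec_def axis_def inj_on_def fun_eq_iff)

lemma coord_embed_add: "coord_embed e (v + w) = coord_embed e v + coord_embed e w"
  and coord_embed_scale: "coord_embed e (c *s v) = cscale c (coord_embed e v)"
  by (auto simp: coord_embed_def fun_eq_iff)

text \<open>A linear bound on the defect makes properness explicit. The constant is 1 for the
  identity and depends on the centre for an involution.\<close>

lemma proper_holomorphic_coord_embed:
  fixes f :: "complex ^ 'n \<Rightarrow> complex ^ 'n"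
  assumes f: "ball_holomorphic f" and C: "C > 0"
    "\<And>z. norm z < 1 \<Longrightarrow> 1 - (norm (f z))\<^sup>2 \<le> C * (1 - (norm z)\<^sup>2)"
  shows "proper_holomorphic CARD('n) (\<lambda>z. coord_embed e (f z))"
  unfolding proper_holomorphic_iff cnorm_coord_embed
proof (intro conjI ballI allI impI)
  show "coord_embed e (f z) \<in> cspace CARD('n)" for z by (rule coord_embed_cspace)
  show "norm (f z) < 1" if "z \<in> ball 0 1" for z using ball_holomorphic_norm[OF f] that by simp
  show "mholomorphic_on (\<lambda>z. coord_embed e (f z) i) (ball 0 1)" if "i < CARD('n)" for i
    using f that by (simp add: coord_embed_def ball_holomorphic_def)
  fix \<epsilon> :: real assume "\<epsilon> > 0"
  have "1 - (norm (f z))\<^sup>2 < \<epsilon>" if "z \<in> ball 0 1" "1 - (norm z)\<^sup>2 < \<epsilon> / C" for z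
    using C(2)[of z] that C(1) by (simp add: field_simps)
  then show "\<exists>d>0. \<forall>z\<in>ball 0 1. 1 - (norm z)\<^sup>2 < d \<longrightarrow> 1 - (norm (f z))\<^sup>2 < \<epsilon>"
    using \<open>\<epsilon> > 0\<close> C(1) by (intro exI[of _ "\<epsilon> / C"]) simp
qed

lemma ball_involution_zero: "ball_involution 0 z = - z"
  by (simp add: ball_involution_def vip_def cip_def vec_eq_iff)

lemma homotopic_ball_involution:
  fixes L :: "complex ^ 'n \<Rightarrow> complex ^ 'n"
  assumes L: "ball_holomorphic L" and eq: "\<And>z. norm z < 1 \<Longrightarrow> norm (L z) = norm z" and a: "norm a < 1"
  shows "homotopic_proper CARD('n) (\<lambda>z. coord_embed e (ball_involution a (L z))) (\<lambda>z. coord_embed e (- L z))"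
proof -
  define b where "b t = of_real (1 - t) *s a" for t :: real
  have b: "norm (b t) < 1" if "0 \<le> t" "t \<le> 1" for t
  proof -
    have "norm (b t) = (1 - t) * norm a"
      unfolding b_def norm_vector_scale norm_of_real using that by simp
    then show ?thesis using a mult_left_le_one_le[of "norm a" "1 - t"] that by simp
  qed
  let ?S = "{0..1::real} \<times> ball (0 :: complex ^ 'n) 1"
  have "continuous_on (ball 0 1) (\<lambda>z. L z $ l)" for l
    using L by (intro mholomorphic_on_imp_continuous_on) (simp add: ball_holomorphic_def)
  then have "continuous_on (snd ` ?S) (\<lambda>z. L z $ l)" for l
    by (rule continuous_on_subset) auto
  from continuous_on_compose[OF continuous_on_snd[OF continuous_on_id] this]
  have cL: "continuous_on ?S (\<lambda>x. L (snd x) $ l)" for l by (simp add: o_def)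
  have cb: "continuous_on ?S (\<lambda>x. b (fst x) $ l)" for l
    unfolding b_def vector_smult_component by (intro continuous_intros)
  have "continuous_on ?S (\<lambda>x. b (fst x))"
    unfolding b_def by (intro bounded_linear.continuous_on[OF bounded_linear_scale_vector] continuous_intros)
  then have cs: "continuous_on ?S (\<lambda>x. of_real (sqrt (1 - (norm (b (fst x)))\<^sup>2)) :: complex)"
    by (intro continuous_on_of_real continuous_on_real_sqrt continuous_on_diff continuous_on_power
        continuous_on_norm continuous_on_const)
  have cv: "continuous_on ?S (\<lambda>x. vip (L (snd x)) (b (fst x)))"
    unfolding vip_def cip_def by (intro continuous_on_sum continuous_on_mult continuous_on_cnj cL cb)
  have denom: "1 - vip (L (snd x)) (b (fst x)) \<noteq> 0"
    "1 + of_real (sqrt (1 - (norm (b (fst x)))\<^sup>2)) \<noteq> (0 :: complex)" if "x \<in> ?S" for x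
    using ball_involution_denom[OF b, of "fst x" "L (snd x)"] ball_involution_s(2)[OF b, of "fst x"]
      ball_holomorphic_norm[OF L, of "snd x"] that by (auto simp: mem_Times_iff)
  show ?thesis
  proof (rule homotopic_properI[where H = "\<lambda>t z. coord_embed e (ball_involution (b t) (L z))"])
    fix i assume "i < CARD('n)"
    then show "continuous_on ?S (\<lambda>x. coord_embed e (ball_involution (b (fst x)) (L (snd x))) i)"
      unfolding coord_embed_def ball_involution_def Let_def vector_smult_component vector_minus_component
      by (simp only: if_True)
         (intro continuous_on_mult continuous_on_diff continuous_on_divide continuous_on_inverse
          continuous_on_add continuous_on_const cL cb cs cv ballI denom)
  next
    fix t :: real assume t: "0 \<le> t" "t \<le> 1"
    show "proper_holomorphic CARD('n) (\<lambda>z. coord_embed e (ball_involution (b t) (L z)))"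
    proof (rule proper_holomorphic_coord_embed)
      show "ball_holomorphic (\<lambda>z. ball_involution (b t) (L z))"
        by (rule ball_involution_mholomorphic[OF b[OF t] L])
      \<comment> \<open>Since |L z| < 1, the denominator 1 - <L z, b t> has modulus at least
        \<open>r\<close>; the defect identity then gives the constant 1 / r^2.\<close>
      define r where "r = 1 - norm (b t)"
      have r: "r > 0" using b[OF t] by (simp add: r_def)
      then show "1 / r\<^sup>2 > 0" by simp
      fix z :: "complex ^ 'n" assume z: "norm z < 1"
      have Lz: "norm (L z) < 1" using ball_holomorphic_norm[OF L z] .
      have "cmod (vip (L z) (b t)) \<le> norm (b t)"
        using norm_vip_le[of "L z" "b t"] Lz mult_left_le_one_le[of "norm (b t)" "norm (L z)"] by simp
      then have "r \<le> cmod (1 - vip (L z) (b t))"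
        using norm_triangle_ineq2[of 1 "vip (L z) (b t)"] by (simp add: r_def)
      then have "r\<^sup>2 \<le> (cmod (1 - vip (L z) (b t)))\<^sup>2" using r by (intro power_mono) auto
      moreover have "(norm z)\<^sup>2 < 1" using z by (simp add: abs_square_less_1)
      moreover have "(1 - (norm (b t))\<^sup>2) * (1 - (norm z)\<^sup>2) \<le> 1 * (1 - (norm z)\<^sup>2)"
        using calculation by (intro mult_right_mono) auto
      ultimately show "1 - (norm (ball_involution (b t) (L z)))\<^sup>2 \<le> 1 / r\<^sup>2 * (1 - (norm z)\<^sup>2)"
        unfolding ball_involution_norm[OF b[OF t] Lz] eq[OF z] using r
        by (simp add: frac_le)
    qed
  qed (simp_all add: b_def ball_involution_zero)
qed

text \<open>\<Lambda> carries the coordinate basis to an orthonormal basis. A product of reflections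
  with the same effect agrees with \<Lambda> by linearity and comes with a deformation.\<close>

lemma homotopic_linear_isometry:
  assumes add: "\<And>v w. \<Lambda> (v + w) = \<Lambda> v + \<Lambda> w" and scale: "\<And>c v. \<Lambda> (c *s v) = c *s \<Lambda> v"
    and norm: "\<And>v. norm (\<Lambda> v) = norm (v :: complex ^ 'n)"
  shows "homotopic_proper CARD('n) (\<lambda>z. coord_embed e z) (\<lambda>z. coord_embed e (\<Lambda> z))"
proof -
  let ?n = "CARD('n)"
  define b where "b i = coord_embed e (\<Lambda> (axis (e i) 1))" for i
  have ip: "hinner ?n (coord_embed e (\<Lambda> v)) (coord_embed e (\<Lambda> w)) = hinner ?n (coord_embed e v) (coord_embed e w)" for v w
    unfolding hinner_eq_cip
    by (rule polarization)
       (simp only: coord_embed_scale[symmetric] coord_embed_add[symmetric] add[symmetric] scale[symmetric] cnorm_coord_embed norm)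
  have "orthonormal ?n ?n (\<lambda>i. unit_vec (id i))" by (rule orthonormal_unit_vec) auto
  then have u: "orthonormal ?n ?n unit_vec" by simp
  have "hinner ?n (b i) (b j) = hinner ?n (unit_vec i) (unit_vec j)" if "i < ?n" "j < ?n" for i j
    using that by (simp add: b_def ip coord_embed_axis)
  then have "orthonormal ?n ?n b"
    using u coord_embed_cspace by (simp add: orthonormal_def b_def)
  from unitary_moves_orthonormal[OF u this, where 'n = 'n]
  obtain T where T: "unitary ?n T" "\<And>i. i < ?n \<Longrightarrow> T (unit_vec i) = b i"
    and hT: "\<And>f :: complex ^ 'n \<Rightarrow> nat \<Rightarrow> complex.
        proper_holomorphic ?n f \<Longrightarrow> homotopic_proper ?n f (\<lambda>z. T (f z))"
    by blast
  have "T (coord_embed e z) = coord_embed e (\<Lambda> z)" for z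
  proof -
    have "\<Lambda> 0 = 0" using add[of 0 0] by simp
    then have L_sum: "\<Lambda> (sum f A) = (\<Sum>i\<in>A. \<Lambda> (f i))" for f :: "'n \<Rightarrow> complex ^ 'n" and A
      by (induction A rule: infinite_finite_induct) (simp_all add: add)
    have emb_sum: "coord_embed e (sum f A) = (\<Sum>i\<in>A. coord_embed e (f i))" for f :: "nat \<Rightarrow> complex ^ 'n" and A
      by (simp add: fun_eq_iff coord_embed_def sum_fun_apply)
    have "\<Lambda> z = (\<Sum>l\<in>UNIV. z $ l *s \<Lambda> (axis l 1))"
      by (subst basis_expansion[of z, symmetric]) (simp only: L_sum scale)
    also have "\<dots> = (\<Sum>i<?n. z $ e i *s \<Lambda> (axis (e i) 1))"
      by (rule sum.reindex_bij_betw[OF e, symmetric])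
    finally have "coord_embed e (\<Lambda> z) = (\<Sum>i<?n. cscale (z $ e i) (b i))"
      by (simp only: emb_sum coord_embed_scale b_def)
    also have "\<dots> = T (\<Sum>i<?n. cscale (coord_embed e z i) (unit_vec i))"
      unfolding unitary_sum[OF T(1)] by (rule sum.cong) (simp_all add: unitary_scale[OF T(1)] T(2) coord_embed_def)
    also have "\<dots> = T (coord_embed e z)"
      using cspace_unit_vec_expansion[OF coord_embed_cspace] by simp
    finally show ?thesis by simp
  qed
  moreover have "proper_holomorphic ?n (\<lambda>z. coord_embed e z)"
    by (rule proper_holomorphic_coord_embed[where C = 1])
       (simp_all add: ball_holomorphic_def mholomorphic_on_coord)
  ultimately show ?thesis using hT[of "\<lambda>z. coord_embed e z"] by simp
qed

text \<open>Norm preservation of \<open>L\<close> needs the Schwarz lemma twice, for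
  \<open>L\<close> and for its inverse \<open>M\<close>; this is where the holomorphy of the inverse
  automorphism enters.\<close>

lemma ball_automorphism_homotopic_id:
  assumes \<phi>: "ball_automorphism \<phi>"
  shows "homotopic_proper CARD('n) (\<lambda>z. coord_embed e (\<phi> z)) (\<lambda>z. coord_embed e z)"
proof -
  define \<psi> where "\<psi> = inv_into (ball 0 1) \<phi>"
  have bij: "bij_betw \<phi> (ball 0 1) (ball 0 1)" using \<phi> by (simp add: ball_automorphism_def)
  then have bij': "bij_betw \<psi> (ball 0 1) (ball 0 1)" unfolding \<psi>_def by (rule bij_betw_inv_into)
  have \<phi>_hol: "ball_holomorphic \<phi>" and \<psi>_hol: "ball_holomorphic \<psi>"
    using \<phi> bij_betw_imp_surj_on[OF bij] bij_betw_imp_surj_on[OF bij']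
    by (simp_all add: ball_automorphism_def ball_holomorphic_def \<psi>_def)
  have \<psi>\<phi>: "\<psi> (\<phi> z) = z" if "norm z < 1" for z
    using bij_betw_inv_into_left[OF bij] that by (simp add: \<psi>_def)
  define a where "a = \<phi> 0"
  have a: "norm a < 1" using ball_holomorphic_norm[OF \<phi>_hol, of 0] by (simp add: a_def)
  define L where "L z = ball_involution a (\<phi> z)" for z
  define M where "M z = \<psi> (ball_involution a z)" for z
  have L: "ball_holomorphic L" "L 0 = 0"
    using ball_involution_mholomorphic[OF a \<phi>_hol] ball_involution_self[OF a]
    by (simp_all add: L_def[abs_def] a_def)
  have id: "ball_holomorphic (\<lambda>z :: complex ^ 'n. z)"
    by (simp add: ball_holomorphic_def mholomorphic_on_coord)
  have inv: "ball_holomorphic (ball_involution a)"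
    using ball_involution_mholomorphic[OF a id] by simp
  have M: "ball_holomorphic M"
    unfolding ball_holomorphic_def
  proof (intro conjI allI)
    show "M ` ball 0 1 \<subseteq> ball 0 1"
      using ball_holomorphic_norm[OF \<psi>_hol ball_involution_in_ball[OF a]] by (simp add: M_def image_subset_iff)
    show "mholomorphic_on (\<lambda>z. M z $ l) (ball 0 1)" for l
      unfolding M_def
      by (rule mholomorphic_on_compose[where f = "\<lambda>w. \<psi> w $ l" and S = "ball 0 1"])
         (use inv \<psi>_hol in \<open>simp_all add: ball_holomorphic_def\<close>)
  qed
  have "ball_involution a 0 = a"
    using ball_involution_involution[OF a a] ball_involution_self[OF a] by simp
  then have M0: "M 0 = 0" using \<psi>\<phi>[of 0] by (simp add: M_def a_def)
  have inv_L: "ball_involution a (L z) = \<phi> z" if "norm z < 1" for z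
    unfolding L_def using ball_involution_involution[OF a ball_holomorphic_norm[OF \<phi>_hol that]] .
  have eq: "norm (L z) = norm z" if z: "norm z < 1" for z
  proof (rule antisym)
    show "norm (L z) \<le> norm z" by (rule schwarz_ball[OF L z])
    have "norm (M (L z)) \<le> norm (L z)" by (rule schwarz_ball[OF M M0 ball_holomorphic_norm[OF L(1) z]])
    then show "norm z \<le> norm (L z)" using inv_L[OF z] \<psi>\<phi>[OF z] by (simp add: M_def)
  qed
  obtain \<Lambda> where \<Lambda>: "\<And>z. norm z < 1 \<Longrightarrow> L z = \<Lambda> z" "\<And>v w. \<Lambda> (v + w) = \<Lambda> v + \<Lambda> w"
    "\<And>c v. \<Lambda> (c *s v) = c *s \<Lambda> v" "\<And>v. norm (\<Lambda> v) = norm v"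
    using norm_preserving_linear[OF L eq] by blast
  have 1: "homotopic_proper CARD('n) (\<lambda>z. coord_embed e (ball_involution a (L z))) (\<lambda>z. coord_embed e (- L z))"
    by (rule homotopic_ball_involution[OF L(1) eq a])
  \<comment> \<open>\<open>- \<Lambda>\<close> is again a linear isometry, so the sign left by the
    involution with centre 0 does no harm.\<close>
  have 2: "homotopic_proper CARD('n) (\<lambda>z. coord_embed e z) (\<lambda>z. coord_embed e (- \<Lambda> z))"
    by (rule homotopic_linear_isometry) (simp_all add: \<Lambda> vec_eq_iff)
  have 3: "homotopic_proper CARD('n) (\<lambda>z. coord_embed e (ball_involution a (L z))) (\<lambda>z. coord_embed e (\<phi> z))"
    by (rule homotopic_proper_eq) (use homotopic_proper_imp_proper[OF 1] inv_L in simp_all)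
  have 4: "homotopic_proper CARD('n) (\<lambda>z. coord_embed e (- L z)) (\<lambda>z. coord_embed e (- \<Lambda> z))"
    by (rule homotopic_proper_eq) (use homotopic_proper_imp_proper[OF 1] \<Lambda>(1) in simp_all)
  show ?thesis
    by (rule homotopic_proper_trans[OF homotopic_proper_sym[OF 3]
          homotopic_proper_trans[OF 1 homotopic_proper_trans[OF 4 homotopic_proper_sym[OF 2]]]])
qed

end

section \<open>Whitney steps\<close>

text \<open>Left inverse of \<open>coord_embed\<close>. Homotopies of automorphisms take values in
  C^N with N = \<open>CARD('n)\<close>, whereas the second argument of \<open>coord_step\<close> is
  a source vector.\<close>

definition coord_unembed :: "(nat \<Rightarrow> 'n) \<Rightarrow> (nat \<Rightarrow> complex) \<Rightarrow> complex ^ 'n::finite" where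
  "coord_unembed e v = (\<chi> l. v (inv_into {..<CARD('n)} e l))"

lemma coord_unembed_embed:
  assumes "bij_betw e {..<CARD('n)} (UNIV :: 'n::finite set)"
  shows "coord_unembed e (coord_embed e w) = (w :: complex ^ 'n)"
  using inv_into_into[of _ e "{..<CARD('n)}"] bij_betw_inv_into_right[OF assms] bij_betw_imp_surj_on[OF assms]
  by (auto simp: coord_unembed_def coord_embed_def vec_eq_iff)

lemma norm_coord_unembed:
  assumes "bij_betw e {..<CARD('n)} (UNIV :: 'n::finite set)"
  shows "norm (coord_unembed e v :: complex ^ 'n) = cnorm {..<CARD('n)} v"
  unfolding norm_vec_def cnorm_def L2_set_def coord_unembed_def
  using sum.reindex_bij_betw[OF bij_betw_inv_into[OF assms], of "\<lambda>i. (cmod (v i))\<^sup>2"] by simp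

text \<open>One step for a coordinate subspace, the one of the indices in \<open>S\<close>. The orthonormal basis of
  the new target space is labelled by \<open>(S \<times> UNIV) <+> ({..<N} - S)\<close> and enumerated by \<open>\<beta>\<close>.\<close>

definition coord_step ::
  "nat \<Rightarrow> (nat \<Rightarrow> (nat \<times> 'n) + nat) \<Rightarrow> (nat \<Rightarrow> complex) \<Rightarrow> complex ^ 'n::finite \<Rightarrow> nat \<Rightarrow> complex"
  where "coord_step p \<beta> v w = (\<lambda>m. if m < p then case_sum (tensor v w) v (\<beta> m) else 0)"

lemma coord_step_cases:
  assumes "bij_betw \<beta> {..<p} ((S \<times> UNIV) <+> ({..<N} - S))" "S \<subseteq> {..<N}" "m < p"
  obtains i l where "\<beta> m = Inl (i, l)" "i < N" | i where "\<beta> m = Inr i" "i < N"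
  using bij_betwE[OF assms(1)] assms(2,3) that by (force simp: Plus_def)

text \<open>Tensoring multiplies the squared norm of the part of \<open>v\<close> on
  \<open>S\<close> by |w|^2 and leaves the rest alone. Subtracted from 1, this is the defect
  identity for a step.\<close>

lemma cnorm_coord_step:
  fixes w :: "complex ^ 'n::finite"
  assumes \<beta>: "bij_betw \<beta> {..<p} ((S \<times> UNIV) <+> ({..<N} - S))" and S: "S \<subseteq> {..<N}" and p: "p \<le> M"
  shows "(cnorm {..<M} (coord_step p \<beta> v w))\<^sup>2 =
    (cnorm {..<N} v)\<^sup>2 - (\<Sum>i\<in>S. (cmod (v i))\<^sup>2) * (1 - (norm w)\<^sup>2)"
proof -
  have fin: "finite S" using S finite_subset by blast
  let ?c = "\<lambda>b. (cmod (case_sum (tensor v w) v b))\<^sup>2"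
  have "(cnorm {..<M} (coord_step p \<beta> v w))\<^sup>2 = (\<Sum>m<M. if m < p then ?c (\<beta> m) else 0)"
    unfolding cnorm_power2 by (rule sum.cong) (simp_all add: coord_step_def)
  also have "\<dots> = (\<Sum>m<p. ?c (\<beta> m))"
    using p by (intro sum.mono_neutral_cong_right) auto
  also have "\<dots> = sum ?c ((S \<times> UNIV) <+> ({..<N} - S))"
    by (rule sum.reindex_bij_betw[OF \<beta>])
  also have "\<dots> = (\<Sum>x\<in>S \<times> UNIV. ?c (Inl x)) + (\<Sum>i\<in>{..<N} - S. ?c (Inr i))"
    using fin by (subst sum.Plus) simp_all
  also have "(\<Sum>x\<in>S \<times> UNIV. ?c (Inl x)) = (\<Sum>i\<in>S. \<Sum>l\<in>UNIV. (cmod (v i))\<^sup>2 * (cmod (w $ l))\<^sup>2)"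
    unfolding sum.cartesian_product by (rule sum.cong) (auto simp: tensor_def norm_mult power_mult_distrib)
  also have "\<dots> = (\<Sum>i\<in>S. (cmod (v i))\<^sup>2) * (norm w)\<^sup>2"
    by (simp add: sum_product norm_vec_def L2_set_def sum_nonneg)
  also have "(\<Sum>i\<in>{..<N} - S. ?c (Inr i)) = (cnorm {..<N} v)\<^sup>2 - (\<Sum>i\<in>S. (cmod (v i))\<^sup>2)"
    using sum.subset_diff[OF S, of "\<lambda>i. (cmod (v i))\<^sup>2"]
    by (simp add: cnorm_power2)
  finally show ?thesis by (simp add: algebra_simps)
qed

text \<open>The defect of the step is positive and at most the sum of the defects of
  \<open>f\<close> and \<open>h\<close>, as the weight \<open>s\<close> of the tensored part lies
  between 0 and 1.\<close>

lemma proper_holomorphic_coord_step: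
  fixes f h :: "complex ^ 'n::finite \<Rightarrow> nat \<Rightarrow> complex"
  assumes e: "bij_betw e {..<CARD('n)} (UNIV :: 'n set)"
    and \<beta>: "bij_betw \<beta> {..<p} ((S \<times> UNIV) <+> ({..<N} - S))" and S: "S \<subseteq> {..<N}" and p: "p \<le> M"
    and f: "proper_holomorphic N f" and h: "proper_holomorphic CARD('n) h"
  shows "proper_holomorphic M (\<lambda>z. coord_step p \<beta> (f z) (coord_unembed e (h z)))"
proof -
  let ?G = "\<lambda>z. coord_step p \<beta> (f z) (coord_unembed e (h z))"
  define F2 where "F2 z = 1 - (cnorm {..<N} (f z))\<^sup>2" for z
  define H2 where "H2 z = 1 - (cnorm {..<CARD('n)} (h z))\<^sup>2" for z
  have defect: "0 < 1 - (cnorm {..<M} (?G z))\<^sup>2" "1 - (cnorm {..<M} (?G z))\<^sup>2 \<le> F2 z + H2 z"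
    if z: "norm z < 1" for z
  proof -
    define s where "s = (\<Sum>i\<in>S. (cmod (f z i))\<^sup>2)"
    have F2: "F2 z > 0" using proper_holomorphic_cnorm_less[OF f z] by (simp add: F2_def abs_square_less_1)
    have H2: "H2 z > 0" using proper_holomorphic_cnorm_less[OF h z] by (simp add: H2_def abs_square_less_1)
    have "s \<le> (\<Sum>i<N. (cmod (f z i))\<^sup>2)" unfolding s_def by (rule sum_mono2) (use S in auto)
    also have "\<dots> = (cnorm {..<N} (f z))\<^sup>2" by (simp add: cnorm_power2)
    finally have s: "0 \<le> s" "s \<le> 1" using F2 by (auto simp: s_def F2_def sum_nonneg)
    have G: "1 - (cnorm {..<M} (?G z))\<^sup>2 = F2 z + s * H2 z"
      unfolding cnorm_coord_step[OF \<beta> S p] norm_coord_unembed[OF e] by (simp add: s_def F2_def H2_def)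
    show "0 < 1 - (cnorm {..<M} (?G z))\<^sup>2"
      unfolding G using F2 H2 s by (intro add_pos_nonneg mult_nonneg_nonneg) auto
    show "1 - (cnorm {..<M} (?G z))\<^sup>2 \<le> F2 z + H2 z"
      unfolding G using H2 s mult_left_le_one_le[of "H2 z" s] by simp
  qed
  have hol_h: "mholomorphic_on (\<lambda>z. coord_unembed e (h z) $ l) (ball 0 1)" for l
  proof -
    have "inv_into {..<CARD('n)} e l < CARD('n)"
      using inv_into_into[of l e "{..<CARD('n)}"] bij_betw_imp_surj_on[OF e] by auto
    then show ?thesis
      using proper_holomorphic_mholomorphic_on[OF h] by (simp add: coord_unembed_def)
  qed
  show ?thesis
    unfolding proper_holomorphic_iff
  proof (intro conjI ballI allI impI)
    show "?G z \<in> cspace M" for z using p by (simp add: coord_step_def cspace_def)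
    show "cnorm {..<M} (?G z) < 1" if "z \<in> ball 0 1" for z
      using defect(1)[of z] that by (simp add: abs_square_less_1)
    show "mholomorphic_on (\<lambda>z. ?G z m) (ball 0 1)" for m
    proof (cases "m < p")
      case True
      then show ?thesis
        by (cases rule: coord_step_cases[OF \<beta> S True])
           (simp_all add: coord_step_def tensor_def proper_holomorphic_mholomorphic_on[OF f]
             mholomorphic_on_mult hol_h)
    qed (simp add: coord_step_def mholomorphic_on_const)
    fix \<epsilon> :: real assume "\<epsilon> > 0"
    then have \<epsilon>: "\<epsilon> / 2 > 0" by simp
    obtain d1 where d1: "d1 > 0" "\<And>z. norm z < 1 \<Longrightarrow> 1 - (norm z)\<^sup>2 < d1 \<Longrightarrow> F2 z < \<epsilon> / 2"
      unfolding F2_def using proper_holomorphic_boundary[OF f \<epsilon>] by blast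
    obtain d2 where d2: "d2 > 0" "\<And>z. norm z < 1 \<Longrightarrow> 1 - (norm z)\<^sup>2 < d2 \<Longrightarrow> H2 z < \<epsilon> / 2"
      unfolding H2_def using proper_holomorphic_boundary[OF h \<epsilon>] by blast
    have "1 - (cnorm {..<M} (?G z))\<^sup>2 < \<epsilon>" if "norm z < 1" "1 - (norm z)\<^sup>2 < min d1 d2" for z
      using defect(2)[OF that(1)] d1(2)[OF that(1)] d2(2)[OF that(1)] that(2) by linarith
    then show "\<exists>d>0. \<forall>z\<in>ball 0 1. 1 - (norm z)\<^sup>2 < d \<longrightarrow> 1 - (cnorm {..<M} (?G z))\<^sup>2 < \<epsilon>"
      using d1(1) d2(1) by (intro exI[of _ "min d1 d2"]) simp
  qed
qed

text \<open>Both arguments move with the same parameter. Each component is an entry of the first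
  homotopy or a product of one with an entry of the second, hence jointly continuous.\<close>

lemma homotopic_proper_coord_step:
  fixes f f' h h' :: "complex ^ 'n::finite \<Rightarrow> nat \<Rightarrow> complex"
  assumes e: "bij_betw e {..<CARD('n)} (UNIV :: 'n set)"
    and \<beta>: "bij_betw \<beta> {..<p} ((S \<times> UNIV) <+> ({..<N} - S))" and S: "S \<subseteq> {..<N}" and p: "p \<le> M"
    and f: "homotopic_proper N f f'" and h: "homotopic_proper CARD('n) h h'"
  shows "homotopic_proper M (\<lambda>z. coord_step p \<beta> (f z) (coord_unembed e (h z)))
     (\<lambda>z. coord_step p \<beta> (f' z) (coord_unembed e (h' z)))"
proof -
  let ?S = "{0..1::real} \<times> ball (0 :: complex ^ 'n) 1"
  obtain A where A: "\<And>i. continuous_on ?S (\<lambda>x. A (fst x) (snd x) i)"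
    "\<And>t. 0 \<le> t \<Longrightarrow> t \<le> 1 \<Longrightarrow> proper_holomorphic N (A t)" "A 0 = f" "A 1 = f'"
    using homotopic_properE[OF f] by blast
  obtain B where B: "\<And>i. continuous_on ?S (\<lambda>x. B (fst x) (snd x) i)"
    "\<And>t. 0 \<le> t \<Longrightarrow> t \<le> 1 \<Longrightarrow> proper_holomorphic CARD('n) (B t)" "B 0 = h" "B 1 = h'"
    using homotopic_properE[OF h] by blast
  show ?thesis
  proof (rule homotopic_properI[where H = "\<lambda>t z. coord_step p \<beta> (A t z) (coord_unembed e (B t z))"])
    fix m
    show "continuous_on ?S
        (\<lambda>x. coord_step p \<beta> (A (fst x) (snd x)) (coord_unembed e (B (fst x) (snd x))) m)"
    proof (cases "m < p")
      case True
      show ?thesis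
        by (cases rule: coord_step_cases[OF \<beta> S True])
           (simp_all add: coord_step_def tensor_def coord_unembed_def True A(1) B(1) continuous_on_mult)
    qed (simp add: coord_step_def)
  next
    show "proper_holomorphic M (\<lambda>z. coord_step p \<beta> (A t z) (coord_unembed e (B t z)))"
      if "0 \<le> t" "t \<le> 1" for t
      by (rule proper_holomorphic_coord_step[OF e \<beta> S p A(2)[OF that] B(2)[OF that]])
  qed (simp_all add: A B)
qed

section \<open>Linear isometries on the tensor sum\<close>

lemma cip_case_sum:
  assumes "finite I" "finite J"
  shows "cip (I <+> J) (case_sum x v) (case_sum y w) = cip I x y + cip J v w"
  unfolding cip_def using assms by (subst sum.Plus) simp_all

lemma cip_tensor: "cip (I \<times> UNIV) (tensor v w) (tensor v' w') = cip I v v' * vip w w'"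
  unfolding cip_def vip_def sum_product sum.cartesian_product
  by (rule sum.cong) (auto simp: tensor_def)

lemma vip_axis: "vip (axis k 1) (axis l 1) = of_bool (k = l)"
  by (simp add: vip_def cip_def axis_def if_distrib[of cnj] if_distrib[of "(*) _"] cong: if_cong)

text \<open>The map of a Whitney step is linear only on this space; closure under the operations
  lets it be moved through finite sums.\<close>

lemma tensor_sum_space_subspace: "cfun.subspace (tensor_sum_space N A :: ((nat \<times> 'n::finite) + nat \<Rightarrow> complex) set)"
proof -
  have add: "case_sum T v + case_sum T' v' = case_sum (T + T') (v + v')"
    and scale: "cscale c (case_sum T v) = case_sum (cscale c T) (cscale c v)"
    and zero: "(0 :: (nat \<times> 'n) + nat \<Rightarrow> complex) = case_sum 0 0"
    for T T' :: "nat \<times> 'n \<Rightarrow> complex" and v v' :: "nat \<Rightarrow> complex" and c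
    by (auto simp: fun_eq_iff split: sum.split)
  have compl: "cfun.subspace (orth_compl N A)"
    by (auto simp: cfun.subspace_def orth_compl_def hinner_eq_cip cip_simps cspace_zero cspace_add cspace_scale)
  show ?thesis
    unfolding cfun.subspace_def tensor_sum_space_def
  proof (intro conjI ballI allI, goal_cases)
    case 1
    show ?case
      by (intro CollectI exI conjI, rule zero) (rule cfun.span_zero, rule cfun.subspace_0[OF compl])
  next
    case (2 x y)
    then obtain T v T' v' where "x = case_sum T v" "y = case_sum T' v'"
      "T \<in> cfun.span {tensor a w |a w. a \<in> A}" "T' \<in> cfun.span {tensor a w |a w. a \<in> A}"
      "v \<in> orth_compl N A" "v' \<in> orth_compl N A"
      by blast
    then show ?case
      using add[of T v T' v'] cfun.span_add cfun.subspace_add[OF compl] by blast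
  next
    case (3 c x)
    then obtain T v where "x = case_sum T v" "T \<in> cfun.span {tensor a w |a w. a \<in> A}" "v \<in> orth_compl N A"
      by blast
    then show ?case
      using scale[of c T v] cfun.span_scale cfun.subspace_scale[OF compl] by blast
  qed
qed

lemma linear_isometry_on_sum:
  assumes W: "cfun.subspace W" and j: "linear_isometry_on W I M j" and w: "\<And>b. b \<in> B \<Longrightarrow> w b \<in> W"
  shows "j (\<Sum>b\<in>B. cscale (c b) (w b)) = (\<Sum>b\<in>B. cscale (c b) (j (w b)))"
proof -
  have j0: "j 0 = 0"
  proof -
    have "j (cscale 0 0) = cscale 0 (j 0)"
      using j cfun.subspace_0[OF W] unfolding linear_isometry_on_def by blast
    then show ?thesis by simp
  qed
  show ?thesis
    using w
  proof (induction B rule: infinite_finite_induct)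
    case (insert b B)
    have "(\<Sum>b\<in>B. cscale (c b) (w b)) \<in> W" "cscale (c b) (w b) \<in> W"
      using insert.prems by (auto intro: cfun.subspace_sum[OF W] cfun.subspace_scale[OF W])
    then have eq: "j (cscale (c b) (w b) + (\<Sum>b\<in>B. cscale (c b) (w b))) =
        cscale (c b) (j (w b)) + j (\<Sum>b\<in>B. cscale (c b) (w b))"
      using j insert.prems unfolding linear_isometry_on_def by (metis insertI1)
    have "j (\<Sum>b\<in>B. cscale (c b) (w b)) = (\<Sum>b\<in>B. cscale (c b) (j (w b)))"
      by (rule insert.IH) (rule insert.prems, simp)
    with eq show ?case
      by (simp only: sum.insert[OF insert.hyps])
  qed (simp_all add: j0)
qed

lemma linear_isometry_on_cip:
  assumes W: "cfun.subspace W" and j: "linear_isometry_on W I M j" and x: "x \<in> W" and y: "y \<in> W"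
  shows "cip {..<M} (j x) (j y) = cip I x y"
proof (rule polarization[symmetric])
  fix c
  have cy: "cscale c y \<in> W" by (rule cfun.subspace_scale[OF W y])
  have "j (x + cscale c y) = j x + cscale c (j y)"
    using j x y cy unfolding linear_isometry_on_def by metis
  moreover have "x + cscale c y \<in> W" by (rule cfun.subspace_add[OF W x cy])
  ultimately show "cnorm I (x + cscale c y) = cnorm {..<M} (j x + cscale c (j y))"
    using j unfolding linear_isometry_on_def by metis
qed

text \<open>The transposition of 0 and \<open>i0\<close>. It places the first basis vector of the
  subspace at the coordinate \<open>i0\<close>.\<close>

lemma transpose_into:
  assumes "0 < d" "d \<le> N" "i0 < N"
  obtains s :: "nat \<Rightarrow> nat" where "inj_on s {..<d}" "s ` {..<d} \<subseteq> {..<N}" "s 0 = i0"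
proof -
  let ?s = "\<lambda>i. if i = 0 then i0 else if i = i0 then 0 else i"
  have "inj_on ?s {..<d}" "?s ` {..<d} \<subseteq> {..<N}" "?s 0 = i0"
    using assms by (auto simp: inj_on_def split: if_splits)
  then show ?thesis by (rule that)
qed

text \<open>A single step, reduced to a coordinate step at the cost of replacing \<open>F\<close> by
  a homotopic \<open>f\<close>. The index \<open>i0\<close> can be prescribed because the unitary
  map adapting the basis may start from any \<open>d\<close> coordinate vectors.\<close>

lemma whitney_step_homotopic_coord_step:
  fixes F G :: "complex ^ 'n::finite \<Rightarrow> nat \<Rightarrow> complex"
  assumes e: "bij_betw e {..<CARD('n)} (UNIV :: 'n set)"
    and step: "whitney_step N M F G" and F: "proper_holomorphic N F" and i0: "i0 < N"
  shows "\<exists>S p \<beta> \<phi> f. S \<subseteq> {..<N} \<and> i0 \<in> S \<and> bij_betw \<beta> {..<p} ((S \<times> (UNIV :: 'n set)) <+> ({..<N} - S)) \<and>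
    p \<le> M \<and> ball_automorphism \<phi> \<and> homotopic_proper N f F \<and>
    homotopic_proper M (\<lambda>z. coord_step p \<beta> (f z) (\<phi> z)) G"
proof -
  obtain A \<phi> j where A: "cfun.subspace A" "A \<subseteq> cspace N" "A \<noteq> {0}" and \<phi>: "ball_automorphism \<phi>"
    and j: "linear_isometry_on (tensor_sum_space N A) (({..<N} \<times> (UNIV :: 'n set)) <+> {..<N}) M j"
    and G: "\<And>z. z \<in> ball 0 1 \<Longrightarrow>
      G z = j (case_sum (tensor (orth_proj N A (F z)) (\<phi> z)) (F z - orth_proj N A (F z)))"
    using step unfolding whitney_step_def by blast
  let ?W = "tensor_sum_space N A :: ((nat \<times> 'n) + nat \<Rightarrow> complex) set"
  let ?I = "({..<N} \<times> (UNIV :: 'n set)) <+> {..<N}"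
  note W = tensor_sum_space_subspace[of N A, where 'n = 'n]
  obtain d a where a: "orthonormal N d a" "\<And>i. i < d \<Longrightarrow> a i \<in> A"
    and aA: "\<And>v. v \<in> A \<Longrightarrow> v = (\<Sum>i<d. cscale (hinner N v (a i)) (a i))"
    using orthonormal_basis_exists[OF A(1,2)] by blast
  \<comment> \<open>Without a basis vector of \<open>A\<close> there would be nothing to place at
    \<open>i0\<close>.\<close>
  have "d > 0"
  proof (rule ccontr)
    assume "\<not> d > 0"
    then have "v = 0" if "v \<in> A" for v using aA[OF that] by simp
    then show False using A(3) cfun.subspace_0[OF A(1)] by blast
  qed
  then obtain s where s: "inj_on s {..<d}" "s ` {..<d} \<subseteq> {..<N}" "s 0 = i0"
    using transpose_into[OF _ orthonormal_card_le[OF a(1)] i0] by blast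
  define S where "S = s ` {..<d}"
  have S: "S \<subseteq> {..<N}" "i0 \<in> S" using s \<open>d > 0\<close> by (auto simp: S_def)
  then have fin: "finite S" using finite_subset by blast
  obtain U where U: "unitary N U" "\<And>i. i < d \<Longrightarrow> U (unit_vec (s i)) = a i"
    and hU: "\<And>f :: complex ^ 'n \<Rightarrow> nat \<Rightarrow> complex.
        proper_holomorphic N f \<Longrightarrow> homotopic_proper N f (\<lambda>z. U (f z))"
    using unitary_moves_orthonormal[OF orthonormal_unit_vec[OF s(1,2)] a(1), where 'n = 'n] by blast
  \<comment> \<open>An orthonormal basis of C^N adapted to \<open>A\<close>: the vectors with index
    in \<open>S\<close> are the basis of \<open>A\<close>, the others lie in its complement.\<close>
  define u where "u i = U (unit_vec i)" for i
  have "orthonormal N N (\<lambda>i. unit_vec (id i))" by (rule orthonormal_unit_vec) auto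
  then have u: "orthonormal N N u"
    unfolding orthonormal_def u_def by (simp add: unitary_hinner[OF U(1)] unitary_cspace[OF U(1)])
  have us: "u (s i) = a i" if "i < d" for i using U(2)[OF that] by (simp add: u_def)
  have uA: "u i \<in> A" if "i \<in> S" for i using that us a(2) by (auto simp: S_def)
  have uAc: "u i \<in> orth_compl N A" if i: "i < N" "i \<notin> S" for i
  proof -
    have "hinner N (u i) v = 0" if v: "v \<in> A" for v
    proof -
      have "hinner N (u i) v = (\<Sum>k<d. cnj (hinner N v (a k)) * hinner N (u i) (a k))"
        by (subst aA[OF v]) (simp only: hinner_eq_cip cip_sum_right cip_scale_right)
      also have "\<dots> = 0"
      proof (rule sum.neutral, rule ballI)
        fix k assume "k \<in> {..<d}"
        then have "s k \<in> S" by (simp add: S_def)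
        then have "s k < N" "i \<noteq> s k" using S(1) i(2) by auto
        then have "hinner N (u i) (u (s k)) = 0"
          using orthonormal_cip[OF u, of i "s k"] i(1) by (simp add: hinner_eq_cip)
        then show "cnj (hinner N v (a k)) * hinner N (u i) (a k) = 0"
          using us \<open>k \<in> {..<d}\<close> by simp
      qed
      finally show ?thesis .
    qed
    then show ?thesis using orthonormal_cspace[OF u i(1)] by (simp add: orth_compl_def)
  qed
  \<comment> \<open>The adjoint of \<open>U\<close> applied to \<open>F z\<close>, that is, the
    coordinates of \<open>F z\<close> in the basis \<open>u\<close>, padded by zeros to lie in
    C^N.\<close>
  define f where "f z = (\<lambda>i. if i < N then hinner N (F z) (u i) else 0)" for z
  have f_cspace: "f z \<in> cspace N" for z by (simp add: f_def cspace_def)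
  have expand: "F z = (\<Sum>i<N. cscale (f z i) (u i))" if "norm z < 1" for z
  proof -
    have "F z = (\<Sum>i<N. cscale (hinner N (F z) (u i)) (u i))"
      by (rule orthonormal_expansion[OF u proper_holomorphic_cspace[OF F that]])
    also have "\<dots> = (\<Sum>i<N. cscale (f z i) (u i))" by (rule sum.cong) (simp_all only: f_def lessThan_iff if_True)
    finally show ?thesis .
  qed
  have Uf: "U (f z) = F z" if "norm z < 1" for z
  proof -
    have "U (f z) = U (\<Sum>i<N. cscale (f z i) (unit_vec i))"
      using cspace_unit_vec_expansion[OF f_cspace, of z] by simp
    also have "\<dots> = (\<Sum>i<N. cscale (f z i) (u i))"
      by (simp only: unitary_sum[OF U(1)] unitary_scale[OF U(1)] u_def)
    finally show ?thesis using expand[OF that] by simp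
  qed
  have f_norm: "cnorm {..<N} (f z) = cnorm {..<N} (F z)" if "norm z < 1" for z
    using unitary_cnorm[OF U(1), of "f z"] Uf[OF that] by simp
  have f: "proper_holomorphic N f"
    unfolding proper_holomorphic_iff
  proof (intro conjI ballI allI impI)
    show "mholomorphic_on (\<lambda>z. f z i) (ball 0 1)" if "i < N" for i
      unfolding f_def hinner_def using that
      by (simp only: if_True) (intro mholomorphic_on_sum mholomorphic_on_mult mholomorphic_on_const
          proper_holomorphic_mholomorphic_on[OF F], simp)
    fix \<epsilon> :: real assume "\<epsilon> > 0"
    then obtain dd where "dd > 0"
      "\<And>z. norm z < 1 \<Longrightarrow> 1 - (norm z)\<^sup>2 < dd \<Longrightarrow> 1 - (cnorm {..<N} (F z))\<^sup>2 < \<epsilon>"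
      using proper_holomorphic_boundary[OF F] by blast
    then show "\<exists>d>0. \<forall>z\<in>ball 0 1. 1 - (norm z)\<^sup>2 < d \<longrightarrow> 1 - (cnorm {..<N} (f z))\<^sup>2 < \<epsilon>"
      by (intro exI[of _ dd]) (simp add: f_norm)
  qed (use f_cspace proper_holomorphic_cnorm_less[OF F] in \<open>simp_all add: f_norm\<close>)
  have UF: "homotopic_proper N (\<lambda>z. U (f z)) F"
    by (rule homotopic_proper_eq) (use homotopic_proper_imp_proper[OF hU[OF f]] Uf in simp_all)
  have fF: "homotopic_proper N f F" by (rule homotopic_proper_trans[OF hU[OF f] UF])

  have proj: "orth_proj N A (F z) = (\<Sum>i\<in>S. cscale (f z i) (u i))" for z
  proof -
    have "orth_proj N A (F z) = (\<Sum>i<d. cscale (hinner N (F z) (a i)) (a i))"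
      by (rule orth_proj_orthonormal[OF A(1,2) a aA])
    also have "\<dots> = (\<Sum>i<d. cscale (f z (s i)) (u (s i)))"
    proof (rule sum.cong)
      fix i assume i: "i \<in> {..<d}"
      then have "s i < N" using s(2) by auto
      then show "cscale (hinner N (F z) (a i)) (a i) = cscale (f z (s i)) (u (s i))"
        using us i by (simp add: f_def)
    qed simp
    also have "\<dots> = (\<Sum>i\<in>S. cscale (f z i) (u i))"
      unfolding S_def by (subst sum.reindex[OF s(1)]) (simp add: o_def)
    finally show ?thesis .
  qed
  have compl: "F z - orth_proj N A (F z) = (\<Sum>i\<in>{..<N} - S. cscale (f z i) (u i))" if "norm z < 1" for z
    unfolding proj using expand[OF that] sum.subset_diff[OF S(1), of "\<lambda>i. cscale (f z i) (u i)"] by simp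

  define B where "B = (S \<times> (UNIV :: 'n set)) <+> ({..<N} - S)"
  have finB: "finite B" using fin by (simp add: B_def)
  \<comment> \<open>An orthonormal family in the tensor sum, labelled so that the coefficient of
    \<open>w b\<close> in the step is the entry of \<open>coord_step\<close> with label
    \<open>b\<close>.\<close>
  define w :: "(nat \<times> 'n) + nat \<Rightarrow> (nat \<times> 'n) + nat \<Rightarrow> complex"
    where "w b = (case b of Inl (i, l) \<Rightarrow> case_sum (tensor (u i) (axis l 1)) 0 | Inr i \<Rightarrow> case_sum 0 (u i))" for b
  have wW: "w b \<in> ?W" if "b \<in> B" for b
  proof -
    have "case_sum (tensor (u i) (axis l (1::complex))) 0 \<in> ?W" if "i \<in> S" for i and l :: 'n
      unfolding tensor_sum_space_def
      using cfun.span_base[of "tensor (u i) (axis l 1)" "{tensor a w |a w. a \<in> A}"] uA[OF that]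
      by (fastforce simp: orth_compl_def cspace_zero hinner_eq_cip)
    moreover have "case_sum 0 (u i) \<in> ?W" if "i < N" "i \<notin> S" for i
      unfolding tensor_sum_space_def using cfun.span_zero uAc[OF that] by blast
    ultimately show ?thesis using that by (auto simp: B_def w_def)
  qed
  have w_cip: "cip ?I (w b) (w b') = of_bool (b = b')" if "b \<in> B" "b' \<in> B" for b b'
  proof -
    have lt: "i < N" if "i \<in> S" for i using that S(1) by auto
    show ?thesis
      using that lt orthonormal_cip[OF u]
      by (auto simp: B_def w_def cip_case_sum cip_tensor vip_axis)
  qed
  have decomp: "case_sum (tensor (orth_proj N A (F z)) (\<phi> z)) (F z - orth_proj N A (F z)) =
      (\<Sum>b\<in>B. cscale (case_sum (tensor (f z) (\<phi> z)) (f z) b) (w b))" if z: "norm z < 1" for z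
  proof
    fix x :: "(nat \<times> 'n) + nat"
    have "(\<Sum>b\<in>B. cscale (case_sum (tensor (f z) (\<phi> z)) (f z) b) (w b)) x =
        (\<Sum>y\<in>S \<times> UNIV. tensor (f z) (\<phi> z) y * w (Inl y) x) + (\<Sum>i\<in>{..<N} - S. f z i * w (Inr i) x)"
      unfolding B_def using fin by (subst sum.Plus) (simp_all add: sum_fun_apply)
    also have "\<dots> = case_sum (tensor (orth_proj N A (F z)) (\<phi> z)) (F z - orth_proj N A (F z)) x"
    proof (cases x)
      case (Inl kl)
      obtain k l where kl: "kl = (k, l)" by force
      have "(\<Sum>y\<in>S \<times> UNIV. tensor (f z) (\<phi> z) y * w (Inl y) x) =
          (\<Sum>i\<in>S. \<Sum>l'\<in>UNIV. if l' = l then f z i * u i k * \<phi> z $ l else 0)"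
        unfolding sum.cartesian_product
        by (rule sum.cong) (auto simp: w_def Inl kl tensor_def axis_def)
      also have "\<dots> = (\<Sum>i\<in>S. f z i * u i k) * \<phi> z $ l"
        by (simp add: sum_distrib_right)
      finally show ?thesis by (simp add: w_def Inl kl tensor_def proj sum_fun_apply)
    next
      case (Inr k)
      have "(\<Sum>y\<in>S \<times> UNIV. tensor (f z) (\<phi> z) y * w (Inl y) x) = 0"
        by (rule sum.neutral) (auto simp: w_def Inr)
      then show ?thesis unfolding compl[OF z] by (simp add: w_def Inr sum_fun_apply)
    qed
    finally show "case_sum (tensor (orth_proj N A (F z)) (\<phi> z)) (F z - orth_proj N A (F z)) x =
      (\<Sum>b\<in>B. cscale (case_sum (tensor (f z) (\<phi> z)) (f z) b) (w b)) x" by simp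
  qed

  define p where "p = card B"
  obtain \<beta> where \<beta>: "bij_betw \<beta> {..<p} B"
    using ex_bij_betw_nat_finite[OF finB] by (auto simp: p_def atLeast0LessThan)
  have \<beta>B: "\<beta> m \<in> B" if "m < p" for m using bij_betwE[OF \<beta>] that by auto
  define g where "g m = j (w (\<beta> m))" for m
  have g: "orthonormal M p g"
    unfolding orthonormal_def
  proof (intro allI impI conjI)
    fix m assume m: "m < p"
    show "g m \<in> cspace M"
      using j wW[OF \<beta>B[OF m]] by (simp add: linear_isometry_on_def g_def)
    fix m' assume m': "m' < p"
    have "hinner M (g m) (g m') = of_bool (\<beta> m = \<beta> m')"
      unfolding g_def hinner_eq_cip linear_isometry_on_cip[OF W j wW[OF \<beta>B[OF m]] wW[OF \<beta>B[OF m']]]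
      by (rule w_cip[OF \<beta>B[OF m] \<beta>B[OF m']])
    also have "\<beta> m = \<beta> m' \<longleftrightarrow> m = m'"
      using bij_betw_imp_inj_on[OF \<beta>] m m' by (auto simp: inj_on_def)
    finally show "hinner M (g m) (g m') = of_bool (m = m')" .
  qed
  have pM: "p \<le> M" by (rule orthonormal_card_le[OF g])
  have "orthonormal M p (\<lambda>i. unit_vec (id i))" by (rule orthonormal_unit_vec) (use pM in auto)
  then have "orthonormal M p unit_vec" by simp
  \<comment> \<open>The vectors \<open>g\<close> span only the part of C^M reached by the step;
    reflections give a unitary map of all of C^M with these prescribed values.\<close>
  from unitary_moves_orthonormal[OF this g, where 'n = 'n]
  obtain V where V: "unitary M V" "\<And>m. m < p \<Longrightarrow> V (unit_vec m) = g m"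
    and hV: "\<And>f :: complex ^ 'n \<Rightarrow> nat \<Rightarrow> complex.
        proper_holomorphic M f \<Longrightarrow> homotopic_proper M f (\<lambda>z. V (f z))"
    by blast
  have GV: "V (coord_step p \<beta> (f z) (\<phi> z)) = G z" if z: "norm z < 1" for z
  proof -
    let ?c = "\<lambda>b. case_sum (tensor (f z) (\<phi> z)) (f z) b"
    have "G z = (\<Sum>b\<in>B. cscale (?c b) (j (w b)))"
      using z by (subst G) (simp, simp only: decomp linear_isometry_on_sum[OF W j wW])
    also have "\<dots> = (\<Sum>m<p. cscale (?c (\<beta> m)) (j (w (\<beta> m))))"
      by (rule sum.reindex_bij_betw[OF \<beta>, symmetric])
    also have "\<dots> = (\<Sum>m<p. V (cscale (?c (\<beta> m)) (unit_vec m)))"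
      by (rule sum.cong) (simp_all only: unitary_scale[OF V(1)] V(2) g_def lessThan_iff)
    also have "\<dots> = V (\<Sum>m<p. cscale (?c (\<beta> m)) (unit_vec m))"
      by (rule unitary_sum[OF V(1), symmetric])
    also have "(\<Sum>m<p. cscale (?c (\<beta> m)) (unit_vec m)) = coord_step p \<beta> (f z) (\<phi> z)"
    proof
      fix k
      have "(\<Sum>m<p. cscale (?c (\<beta> m)) (unit_vec m)) k = (\<Sum>m<p. if m = k then ?c (\<beta> m) else 0)"
        unfolding sum_fun_apply by (rule sum.cong) (auto simp: unit_vec_def)
      then show "(\<Sum>m<p. cscale (?c (\<beta> m)) (unit_vec m)) k = coord_step p \<beta> (f z) (\<phi> z) k"
        by (simp add: coord_step_def)
    qed
    finally show ?thesis by simp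
  qed
  have \<phi>e: "proper_holomorphic CARD('n) (\<lambda>z. coord_embed e (\<phi> z))"
    using homotopic_proper_imp_proper[OF ball_automorphism_homotopic_id[OF e \<phi>]] by blast
  have cs: "proper_holomorphic M (\<lambda>z. coord_step p \<beta> (f z) (\<phi> z))"
    using proper_holomorphic_coord_step[OF e \<beta>[unfolded B_def] S(1) pM f \<phi>e]
    by (simp only: coord_unembed_embed[OF e])
  have "homotopic_proper M (\<lambda>z. V (coord_step p \<beta> (f z) (\<phi> z))) G"
    by (rule homotopic_proper_eq) (use homotopic_proper_imp_proper[OF hV[OF cs]] GV in simp_all)
  then have "homotopic_proper M (\<lambda>z. coord_step p \<beta> (f z) (\<phi> z)) G"
    by (rule homotopic_proper_trans[OF hV[OF cs]])
  then show ?thesis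
    using S \<beta>[unfolded B_def] pM \<phi> fF by blast
qed

text \<open>A component in \<open>S\<close> is replaced by its products with all variables, the
  others are kept. Positions from \<open>p\<close> on are padding with coefficient 0, so they do not
  count for the degree.\<close>

lemma coord_step_monomial_map:
  fixes c :: "nat \<Rightarrow> complex" and \<alpha> :: "nat \<Rightarrow> 'n::finite \<Rightarrow> nat"
  assumes \<beta>: "bij_betw \<beta> {..<p} ((S \<times> UNIV) <+> ({..<N} - S))" and S: "S \<subseteq> {..<N}" and p: "p \<le> M"
  defines "c' \<equiv> \<lambda>m. if m < p then (case \<beta> m of Inl (i, l) \<Rightarrow> c i | Inr i \<Rightarrow> c i) else 0"
    and "\<alpha>' \<equiv> \<lambda>m l'. case \<beta> m of Inl (i, l) \<Rightarrow> \<alpha> i l' + of_bool (l' = l) | Inr i \<Rightarrow> \<alpha> i l'"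
  shows "coord_step p \<beta> (monomial_map N c \<alpha> z) z = monomial_map M c' \<alpha>' z"
proof
  fix m
  show "coord_step p \<beta> (monomial_map N c \<alpha> z) z m = monomial_map M c' \<alpha>' z m"
  proof (cases "m < p")
    case True
    have "(\<Prod>l'\<in>UNIV. z $ l' ^ of_bool (l' = l)) = (\<Prod>l'\<in>UNIV. if l' = l then z $ l' else 1)" for l
      by (rule prod.cong) auto
    then have "(\<Prod>l'\<in>UNIV. z $ l' ^ of_bool (l' = l)) = z $ l" for l by simp
    with True p show ?thesis
      by (cases rule: coord_step_cases[OF \<beta> S True])
         (simp_all add: coord_step_def tensor_def monomial_map_def c'_def \<alpha>'_def power_add prod.distrib)
  qed (simp add: coord_step_def monomial_map_def c'_def)
qed

text \<open>The degree is split into a bound and an index that attains it with non-zero coefficient.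
  That index is what the next step requires its coordinate subspace to contain.\<close>

lemma whitney_sequence_homotopic_monomial:
  fixes F :: "nat \<Rightarrow> complex ^ 'n::finite \<Rightarrow> nat \<Rightarrow> complex"
  assumes "whitney_sequence N F"
  shows "\<exists>c (\<alpha> :: nat \<Rightarrow> 'n \<Rightarrow> nat). homotopic_proper (N k) (F k) (monomial_map (N k) c \<alpha>) \<and>
    (\<exists>i<N k. c i \<noteq> 0 \<and> (\<Sum>l\<in>UNIV. \<alpha> i l) = k + 1) \<and>
    (\<forall>i<N k. c i \<noteq> 0 \<longrightarrow> (\<Sum>l\<in>UNIV. \<alpha> i l) \<le> k + 1)"
proof -
  obtain \<phi> e where N0: "N 0 = CARD('n)" and \<phi>: "ball_automorphism \<phi>"
    and e: "bij_betw e {..<CARD('n)} (UNIV :: 'n set)"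
    and F0: "\<And>z. z \<in> ball 0 1 \<Longrightarrow> F 0 z = (\<lambda>i. if i < CARD('n) then \<phi> z $ e i else 0)"
    and step: "\<And>k. whitney_step (N k) (N (Suc k)) (F k) (F (Suc k))"
    using assms unfolding whitney_sequence_def by blast
  show ?thesis
  proof (induction k)
    case 0
    define \<alpha> :: "nat \<Rightarrow> 'n \<Rightarrow> nat" where "\<alpha> i l = of_bool (l = e i)" for i l
    have \<alpha>1: "(\<Sum>l\<in>UNIV. \<alpha> i l) = 1" for i by (simp add: \<alpha>_def)
    have "(\<Prod>l\<in>UNIV. z $ l ^ \<alpha> i l) = (\<Prod>l\<in>UNIV. if l = e i then z $ l else 1)"
      for z :: "complex ^ 'n" and i
      by (rule prod.cong) (auto simp: \<alpha>_def)
    then have mono: "monomial_map CARD('n) (\<lambda>_. 1) \<alpha> z = coord_embed e z" for z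
      by (simp add: monomial_map_def coord_embed_def fun_eq_iff)
    have 1: "homotopic_proper CARD('n) (\<lambda>z. coord_embed e (\<phi> z)) (\<lambda>z. coord_embed e z)"
      by (rule ball_automorphism_homotopic_id[OF e \<phi>])
    have 2: "homotopic_proper CARD('n) (\<lambda>z. coord_embed e (\<phi> z)) (F 0)"
      by (rule homotopic_proper_eq) (use homotopic_proper_imp_proper[OF 1] F0 in \<open>simp_all add: coord_embed_def\<close>)
    have "homotopic_proper CARD('n) (F 0) (monomial_map CARD('n) (\<lambda>_. 1) \<alpha>)"
      using homotopic_proper_trans[OF homotopic_proper_sym[OF 2] 1] mono by (simp add: mono[abs_def])
    then show ?case
      unfolding N0 using \<alpha>1 by (intro exI[of _ "\<lambda>_. 1"] exI[of _ \<alpha>]) (auto intro!: exI[of _ 0])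
  next
    case (Suc k)
    then obtain c \<alpha> i0 where h: "homotopic_proper (N k) (F k) (monomial_map (N k) c \<alpha>)"
      and i0: "i0 < N k" "c i0 \<noteq> 0" "(\<Sum>l\<in>UNIV. \<alpha> i0 l) = k + 1"
      and le: "\<And>i. i < N k \<Longrightarrow> c i \<noteq> 0 \<Longrightarrow> (\<Sum>l\<in>UNIV. \<alpha> i l) \<le> k + 1"
      by blast
    \<comment> \<open>Properness of the maps in the sequence is not part of its definition; it comes
      from the homotopy of the induction hypothesis.\<close>
    have "proper_holomorphic (N k) (F k)" using homotopic_proper_imp_proper[OF h] by blast
    from whitney_step_homotopic_coord_step[OF e step this i0(1)]
    obtain S p \<beta> \<psi> f where S: "S \<subseteq> {..<N k}" "i0 \<in> S"
      and \<beta>: "bij_betw \<beta> {..<p} ((S \<times> (UNIV :: 'n set)) <+> ({..<N k} - S))"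
      and p: "p \<le> N (Suc k)" and \<psi>: "ball_automorphism \<psi>" and f: "homotopic_proper (N k) f (F k)"
      and G: "homotopic_proper (N (Suc k)) (\<lambda>z. coord_step p \<beta> (f z) (\<psi> z)) (F (Suc k))"
      by blast
    define c' where "c' m = (if m < p then (case \<beta> m of Inl (i, l) \<Rightarrow> c i | Inr i \<Rightarrow> c i) else 0)" for m
    define \<alpha>' where
      "\<alpha>' m l' = (case \<beta> m of Inl (i, l) \<Rightarrow> \<alpha> i l' + of_bool (l' = l) | Inr i \<Rightarrow> \<alpha> i l')" for m l'
    have "homotopic_proper (N (Suc k)) (\<lambda>z. coord_step p \<beta> (f z) (\<psi> z))
        (\<lambda>z. coord_step p \<beta> (monomial_map (N k) c \<alpha> z) z)"
      using homotopic_proper_coord_step[OF e \<beta> S(1) p homotopic_proper_trans[OF f h]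
          ball_automorphism_homotopic_id[OF e \<psi>]]
      by (simp only: coord_unembed_embed[OF e])
    from homotopic_proper_trans[OF homotopic_proper_sym[OF G] this]
    have hom: "homotopic_proper (N (Suc k)) (F (Suc k)) (monomial_map (N (Suc k)) c' \<alpha>')"
      unfolding coord_step_monomial_map[OF \<beta> S(1) p] c'_def[abs_def] \<alpha>'_def[abs_def] .
    have "\<exists>m<N (Suc k). c' m \<noteq> 0 \<and> (\<Sum>l\<in>UNIV. \<alpha>' m l) = Suc k + 1"
    proof -
      \<comment> \<open>Any variable may be multiplied onto the component of maximal degree;
        \<open>undefined\<close> is merely some index of the source.\<close>
      have "Inl (i0, undefined) \<in> \<beta> ` {..<p}"
        using bij_betw_imp_surj_on[OF \<beta>] S(2) by auto
      then obtain m where m: "m < p" "\<beta> m = Inl (i0, undefined)" by auto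
      have "(\<Sum>l\<in>UNIV. \<alpha>' m l) = Suc k + 1"
        using i0(3) by (simp add: \<alpha>'_def m sum.distrib)
      then show ?thesis using m p i0(2) by (intro exI[of _ m]) (simp add: c'_def)
    qed
    \<comment> \<open>A label \<open>Inl\<close> raises the degree of an old component by one, a
      label \<open>Inr\<close> keeps it; the coefficient is the old one in both cases.\<close>
    moreover have "(\<Sum>l\<in>UNIV. \<alpha>' m l) \<le> Suc k + 1" if "c' m \<noteq> 0" for m
    proof -
      have m: "m < p" using that by (simp add: c'_def split: if_splits)
      show ?thesis
        using that le by (cases rule: coord_step_cases[OF \<beta> S(1) m])
          (fastforce simp: c'_def \<alpha>'_def m sum.distrib)+
    qed
    ultimately show ?case using hom by blast
  qed
qed

theorem theorem5p1:
  fixes N :: "nat \<Rightarrow> nat"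
    and F :: "nat \<Rightarrow> complex ^ 'n::finite \<Rightarrow> nat \<Rightarrow> complex"
    and k :: nat
  assumes "whitney_sequence N F"
  shows "\<exists>(c :: nat \<Rightarrow> complex) (\<alpha> :: nat \<Rightarrow> 'n \<Rightarrow> nat).
           proper_holomorphic (N k) (monomial_map (N k) c \<alpha>) \<and>
           monomial_degree (N k) c \<alpha> = k + 1 \<and>
           homotopic_proper (N k) (F k) (monomial_map (N k) c \<alpha>)"
proof -
  obtain c and \<alpha> :: "nat \<Rightarrow> 'n \<Rightarrow> nat" where h: "homotopic_proper (N k) (F k) (monomial_map (N k) c \<alpha>)"
    and ex: "\<exists>i<N k. c i \<noteq> 0 \<and> (\<Sum>l\<in>UNIV. \<alpha> i l) = k + 1"
    and le: "\<forall>i<N k. c i \<noteq> 0 \<longrightarrow> (\<Sum>l\<in>UNIV. \<alpha> i l) \<le> k + 1"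
    using whitney_sequence_homotopic_monomial[OF assms, of k] by blast
  have "monomial_degree (N k) c \<alpha> = k + 1"
    unfolding monomial_degree_def
  proof (rule Max_eqI)
    show "finite {\<Sum>l\<in>UNIV. \<alpha> i l |i. i < N k \<and> c i \<noteq> 0}" by simp
    show "y \<le> k + 1" if "y \<in> {\<Sum>l\<in>UNIV. \<alpha> i l |i. i < N k \<and> c i \<noteq> 0}" for y
      using that le by blast
    show "k + 1 \<in> {\<Sum>l\<in>UNIV. \<alpha> i l |i. i < N k \<and> c i \<noteq> 0}"
      using ex by (metis (mono_tags, lifting) mem_Collect_eq)
  qed
  with h homotopic_proper_imp_proper[OF h] show ?thesis by blast
qed

end
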